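(* Let $S\subset\mathbb{P}^3$ be an irreducible Frobenius classical surface of degree $d>1$ defined over the finite field $\mathbb{F}_q$. Let $C$ be an irreducible curve of degree $\delta$ defined over $\mathbb{F}_q$ and lying on $S$. Suppose that $C$ is not a component of $C_\Phi^S$. Then $$\#C(\mathbb{F}_q)\le \frac{\delta(d+q-1)}{2}.$$
   Context: Let $S\subset\mathbb{P}^3$ be an irreducible projective surface defined over $\mathbb{F}_q$ by $f=0$, where $f\in\mathbb{F}_q[X_0,X_1,X_2,X_3]$ is an irreducible homogeneous polynomial of degree $d$. Write $f_i=\partial f/\partial X_i$ and $$h:=X_0^q f_0+X_1^q f_1+X_2^q f_2+X_3^q f_3 .$$ The variety $C_\Phi^S$ is the zero set of $f=h=0$ in $\mathbb{P}^3$. Set-theoretically it is the union of the singular locus of $S$ and the set of non-singular points $P\in S$ such that $\Phi(P)\in T_PS$, where $\Phi$ is the $q$-Frobenius map $(x_0:x_1:x_2:x_3)\mapsto(x_0^q:x_1^q:x_2^q:x_3^q)$ and $T_PS$ is the projective tangent plane of $S$ at $P$. The surface $S$ is called Frobenius classical if $\dim C_\Phi^S=1$ (i.e. $C_\Phi^S$ is a curve), and Frobenius non-classical otherwise. *)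

theory Defs
  imports
    Complex_Main
    "HOL-Library.Poly_Mapping"
    "HOL-Library.Numeral_Type"
    "HOL-Library.Extended_Nat"
    "HOL-Algebra.Algebraic_Closure_Type"
begin

text \<open>
  Projective varieties over a field \<open>k\<close> are treated classically: they are sets of points of
  \<open>\<P>\<^sup>3\<close> over the algebraic closure of \<open>k\<close>, cut out by homogeneous polynomials with coefficients
  in \<open>k\<close>.  So closedness, irreducibility, dimension and irreducible components all refer to the
  Zariski topology over \<open>k\<close>, in which ``closed'' includes ``defined over \<open>k\<close>''.
  A hypersurface \<open>f = 0\<close> with \<open>f\<close> irreducible in \<open>k[X\<^sub>0, \<dots>, X\<^sub>3]\<close> is irreducible in this sense.
  Dimension does not depend on whether \<open>k\<close> or its closure is used, and for perfect \<open>k\<close>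
  (for instance \<open>k\<close> finite) neither does the degree defined below.  A geometrically irreducible
  variety defined over \<open>k\<close> is irreducible over \<open>k\<close>.
\<close>

subsection \<open>Polynomials in four variables\<close>

text \<open>The variables are indexed by the four-element type \<open>4\<close>, with elements \<open>0, 1, 2, 3\<close>.\<close>

type_synonym 'k poly4 = "(4 \<Rightarrow>\<^sub>0 nat) \<Rightarrow>\<^sub>0 'k"

definition Var :: "4 \<Rightarrow> 'k::field poly4" where
  "Var i = Poly_Mapping.single (Poly_Mapping.single i 1) 1"

definition scale4 :: "'k::field \<Rightarrow> 'k poly4 \<Rightarrow> 'k poly4" where
  "scale4 c p = Poly_Mapping.single 0 c * p"

text \<open>The zero polynomial is homogeneous of every degree.\<close>

definition homogeneous :: "nat \<Rightarrow> 'k::field poly4 \<Rightarrow> bool" where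
  "homogeneous n p \<longleftrightarrow>
     (\<forall>m\<in>Poly_Mapping.keys p. (\<Sum>i\<in>UNIV. Poly_Mapping.lookup m i) = n)"

text \<open>
  If \<open>X\<^sub>i\<close> does not occur in the monomial \<open>m\<close>, the truncated exponent \<open>m - single i 1\<close> is
  meaningless, but then the coefficient is \<open>0\<close>.
\<close>

definition partial_deriv :: "4 \<Rightarrow> 'k::field poly4 \<Rightarrow> 'k poly4" where
  "partial_deriv i p =
     (\<Sum>m\<in>Poly_Mapping.keys p.
        Poly_Mapping.single (m - Poly_Mapping.single i 1)
          (of_nat (Poly_Mapping.lookup m i) * Poly_Mapping.lookup p m))"

definition eval4 :: "'k::field poly4 \<Rightarrow> (4 \<Rightarrow> 'k alg_closure) \<Rightarrow> 'k alg_closure" where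
  "eval4 p x =
     (\<Sum>m\<in>Poly_Mapping.keys p.
        to_ac (Poly_Mapping.lookup p m) * (\<Prod>i\<in>UNIV. x i ^ Poly_Mapping.lookup m i))"

subsection \<open>Projective space and the Zariski topology\<close>

text \<open>A point \<open>(x\<^sub>0 : x\<^sub>1 : x\<^sub>2 : x\<^sub>3)\<close> is the class of its nonzero coordinate vectors.\<close>

type_synonym 'k point = "(4 \<Rightarrow> 'k alg_closure) set"

definition proj_point :: "(4 \<Rightarrow> 'k::field alg_closure) \<Rightarrow> 'k point" where
  "proj_point x = {\<lambda>i. c * x i | c. c \<noteq> 0}"

definition zero_locus :: "'k::field poly4 set \<Rightarrow> 'k point set" where
  "zero_locus G = {proj_point x | x. x \<noteq> (\<lambda>_. 0) \<and> (\<forall>g\<in>G. eval4 g x = 0)}"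

definition zariski_closed :: "'k::field point set \<Rightarrow> bool" where
  "zariski_closed Z \<longleftrightarrow> (\<exists>G. (\<forall>g\<in>G. \<exists>n. homogeneous n g) \<and> Z = zero_locus G)"

definition irreducible_variety :: "'k::field point set \<Rightarrow> bool" where
  "irreducible_variety Z \<longleftrightarrow> zariski_closed Z \<and> Z \<noteq> {} \<and>
     (\<forall>A B. zariski_closed A \<and> zariski_closed B \<and> Z \<subseteq> A \<union> B \<longrightarrow> Z \<subseteq> A \<or> Z \<subseteq> B)"

definition irreducible_component :: "'k::field point set \<Rightarrow> 'k point set \<Rightarrow> bool" where
  "irreducible_component C Z \<longleftrightarrow> irreducible_variety C \<and> C \<subseteq> Z \<and>
     (\<forall>D. irreducible_variety D \<and> C \<subseteq> D \<and> D \<subseteq> Z \<longrightarrow> D = C)"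

text \<open>Krull dimension of a closed set; the empty set gets the value \<open>0\<close> here.\<close>

definition variety_dim :: "'k::field point set \<Rightarrow> enat" where
  "variety_dim Z =
     Sup {enat n | n. \<exists>W. (\<forall>i\<le>n. irreducible_variety (W i) \<and> W i \<subseteq> Z) \<and>
                          (\<forall>i<n. W i \<subset> W (Suc i))}"

definition rational_points :: "'k::field point set \<Rightarrow> 'k point set" where
  "rational_points Z = {P \<in> Z. \<exists>y. y \<noteq> (\<lambda>_. 0) \<and> P = proj_point (\<lambda>i. to_ac (y i))}"

subsection \<open>Degree of a curve\<close>

definition forms :: "nat \<Rightarrow> 'k::field poly4 set" where
  "forms n = {p. homogeneous n p}"

definition vanishing_forms :: "'k::field point set \<Rightarrow> nat \<Rightarrow> 'k poly4 set" where
  "vanishing_forms Z n = {p \<in> forms n. \<forall>x. x \<noteq> (\<lambda>_. 0) \<and> proj_point x \<in> Z \<longrightarrow> eval4 p x = 0}"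

text \<open>
  The dimension of the degree \<open>n\<close> part of the homogeneous coordinate ring
  \<open>k[X\<^sub>0, \<dots>, X\<^sub>3] / I(Z)\<close>, as a difference of two finite dimensions.
\<close>

definition hilbert_function :: "'k::field point set \<Rightarrow> nat \<Rightarrow> nat" where
  "hilbert_function Z n =
     vector_space.dim scale4 (forms n :: 'k poly4 set)
       - vector_space.dim scale4 (vanishing_forms Z n)"

text \<open>
  The degree of a variety of dimension \<open>r\<close> is \<open>r!\<close> times the leading coefficient of its Hilbert
  polynomial, which has degree \<open>r\<close>.  For a curve, the Hilbert polynomial is thus
  \<open>\<delta> n + c\<close> with \<open>\<delta>\<close> the degree of the curve.
\<close>

definition has_curve_degree :: "'k::field point set \<Rightarrow> nat \<Rightarrow> bool" where
  "has_curve_degree C \<delta> \<longleftrightarrow>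
     (\<exists>c::int. \<forall>\<^sub>F n in sequentially. int (hilbert_function C n) = int \<delta> * int n + c)"

subsection \<open>Frobenius classical surfaces\<close>

definition frobenius_form :: "'k::{field,finite} poly4 \<Rightarrow> 'k poly4" where
  "frobenius_form f = (\<Sum>i\<in>UNIV. Var i ^ CARD('k) * partial_deriv i f)"

definition surface :: "'k::field poly4 \<Rightarrow> 'k point set" where
  "surface f = zero_locus {f}"

definition frobenius_locus :: "'k::{field,finite} poly4 \<Rightarrow> 'k point set" where
  "frobenius_locus f = zero_locus {f, frobenius_form f}"

definition frobenius_classical :: "'k::{field,finite} poly4 \<Rightarrow> bool" where
  "frobenius_classical f \<longleftrightarrow> variety_dim (frobenius_locus f) = 1"

text \<open>Makes the library facts about \<open>vector_space.dim scale4\<close> applicable.\<close>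

lemma vector_space_scale4: "vector_space (scale4 :: 'k::field \<Rightarrow> _)"
  by unfold_locales
    (simp_all add: scale4_def algebra_simps single_add mult_single flip: mult.assoc single_one)

end

theory Submission
  imports Defs
begin

text \<open>
  Write \<open>h\<close> for the Frobenius form of \<open>f\<close> and \<open>m = d + q - 1\<close> for its degree.  As \<open>h\<close> does not vanish
  on \<open>C\<close>, it is not a zero divisor modulo \<open>I(C)\<close>, so the forms of large degree modulo \<open>I(C) + (h)\<close>
  have dimension \<open>\<delta> m\<close>.  At a rational point \<open>P\<close> choose a nonzero tangent vector \<open>v\<close> of \<open>C\<close>.  Frobenius
  fixes \<open>P\<close> and has zero differential, so Euler's formula shows that \<open>h\<close>, like every form in \<open>I(C)\<close>,
  vanishes to second order on the line through \<open>P\<close> in direction \<open>v\<close>.  The value and the derivative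
  along \<open>v\<close> at each rational point are thus linear functionals killing \<open>I(C) + (h)\<close>; in large degree
  they are independent, whence \<open>2 #C(\<F>\<^sub>q) \<le> \<delta> m\<close>.  Dimensions are compared by counting
  elements, as all spaces of forms are finite.
\<close>

subsection \<open>Evaluation and homogeneity\<close>

text \<open>One substitution serves two purposes: with \<open>to_ac\<close> it is evaluation at a
  geometric point, with constant polynomials as coefficients it is restriction to a line.\<close>

definition eval_via ::
    "('k::field \<Rightarrow> 'b::comm_ring_1) \<Rightarrow> (4 \<Rightarrow> 'b) \<Rightarrow> 'k poly4 \<Rightarrow> 'b" where
  "eval_via \<phi> x p =
     (\<Sum>m\<in>Poly_Mapping.keys p.
        \<phi> (Poly_Mapping.lookup p m) * (\<Prod>i\<in>UNIV. x i ^ Poly_Mapping.lookup m i))"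

lemma poly_mapping_sum_single:
  "(\<Sum>m\<in>Poly_Mapping.keys p. Poly_Mapping.single m (Poly_Mapping.lookup p m)) = p"
proof (rule poly_mapping_eqI)
  fix k
  have "Poly_Mapping.lookup (\<Sum>m\<in>Poly_Mapping.keys p.
          Poly_Mapping.single m (Poly_Mapping.lookup p m)) k
      = (\<Sum>m\<in>Poly_Mapping.keys p. if k = m then Poly_Mapping.lookup p m else 0)"
    by (auto simp: lookup_sum lookup_single when_def intro!: sum.cong)
  also have "\<dots> = Poly_Mapping.lookup p k"
    by (simp add: not_in_keys_iff_lookup_eq_zero)
  finally show "Poly_Mapping.lookup (\<Sum>m\<in>Poly_Mapping.keys p.
          Poly_Mapping.single m (Poly_Mapping.lookup p m)) k = Poly_Mapping.lookup p k" .
qed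

locale coeff_hom =
  fixes \<phi> :: "'k::field \<Rightarrow> 'b::comm_ring_1"
  assumes hom_0 [simp]: "\<phi> 0 = 0" and hom_1 [simp]: "\<phi> 1 = 1"
    and hom_add: "\<phi> (a + b) = \<phi> a + \<phi> b" and hom_mult: "\<phi> (a * b) = \<phi> a * \<phi> b"
begin

lemma eval_via_superset:
  assumes "finite A" "Poly_Mapping.keys p \<subseteq> A"
  shows "eval_via \<phi> x p =
    (\<Sum>m\<in>A. \<phi> (Poly_Mapping.lookup p m) * (\<Prod>i\<in>UNIV. x i ^ Poly_Mapping.lookup m i))"
  unfolding eval_via_def using assms
  by (intro sum.mono_neutral_left) (auto simp: not_in_keys_iff_lookup_eq_zero)

lemma eval_via_0 [simp]: "eval_via \<phi> x 0 = 0"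
  by (simp add: eval_via_def)

lemma eval_via_add: "eval_via \<phi> x (p + q) = eval_via \<phi> x p + eval_via \<phi> x q"
proof -
  let ?A = "Poly_Mapping.keys p \<union> Poly_Mapping.keys q"
  have "finite ?A" "Poly_Mapping.keys (p + q) \<subseteq> ?A"
    using Poly_Mapping.keys_add[of p q] by auto
  then show ?thesis
    by (simp add: eval_via_superset[of ?A] lookup_add hom_add distrib_right sum.distrib)
qed

lemma eval_via_diff: "eval_via \<phi> x (p - q) = eval_via \<phi> x p - eval_via \<phi> x q"
  using eval_via_add[of x "p - q" q] by simp

lemma eval_via_sum: "eval_via \<phi> x (\<Sum>a\<in>A. g a) = (\<Sum>a\<in>A. eval_via \<phi> x (g a))"
  by (induction A rule: infinite_finite_induct) (auto simp: eval_via_add)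

lemma eval_via_single:
  "eval_via \<phi> x (Poly_Mapping.single m c) = \<phi> c * (\<Prod>i\<in>UNIV. x i ^ Poly_Mapping.lookup m i)"
  by (cases "c = 0") (auto simp: eval_via_def)

lemma eval_via_Var [simp]: "eval_via \<phi> x (Var i) = x i"
proof -
  have "eval_via \<phi> x (Var i) = (\<Prod>j\<in>UNIV. if j = i then x i else 1)"
    unfolding Var_def eval_via_single hom_1 mult_1_left
    by (rule prod.cong) (auto simp: lookup_single when_def)
  then show ?thesis by simp
qed

lemma eval_via_const [simp]: "eval_via \<phi> x (Poly_Mapping.single 0 c) = \<phi> c"
  by (simp add: eval_via_single)

lemma eval_via_1 [simp]: "eval_via \<phi> x 1 = 1"
  using eval_via_const[of x 1] by (simp del: eval_via_const)

lemma eval_via_mult: "eval_via \<phi> x (p * q) = eval_via \<phi> x p * eval_via \<phi> x q"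
proof -
  let ?s = "\<lambda>p m. Poly_Mapping.single m (Poly_Mapping.lookup p m)"
  have "p * q = (\<Sum>m\<in>Poly_Mapping.keys p. ?s p m) * (\<Sum>n\<in>Poly_Mapping.keys q. ?s q n)"
    by (simp only: poly_mapping_sum_single)
  then have "eval_via \<phi> x (p * q) = (\<Sum>m\<in>Poly_Mapping.keys p. \<Sum>n\<in>Poly_Mapping.keys q.
      eval_via \<phi> x (?s p m * ?s q n))"
    by (simp only: sum_product eval_via_sum)
  also have "\<dots> = (\<Sum>m\<in>Poly_Mapping.keys p. \<Sum>n\<in>Poly_Mapping.keys q.
      eval_via \<phi> x (?s p m) * eval_via \<phi> x (?s q n))"
    by (simp add: eval_via_single mult_single hom_mult lookup_add power_add prod.distrib mult_ac)
  also have "\<dots> = eval_via \<phi> x p * eval_via \<phi> x q"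
    unfolding sum_product[symmetric] eval_via_sum[symmetric] poly_mapping_sum_single ..
  finally show ?thesis .
qed

lemma eval_via_scale4 [simp]: "eval_via \<phi> x (scale4 c p) = \<phi> c * eval_via \<phi> x p"
  by (simp add: scale4_def eval_via_mult)

lemma eval_via_power: "eval_via \<phi> x (p ^ n) = eval_via \<phi> x p ^ n"
  by (induction n) (auto simp: eval_via_mult)

lemma eval_via_prod: "eval_via \<phi> x (\<Prod>a\<in>A. g a) = (\<Prod>a\<in>A. eval_via \<phi> x (g a))"
  by (induction A rule: infinite_finite_induct) (auto simp: eval_via_mult)

lemma eval_via_homogeneous:
  assumes "homogeneous n p"
  shows "eval_via \<phi> (\<lambda>i. c * x i) p = c ^ n * eval_via \<phi> x p"
proof -
  have "(\<Prod>i\<in>UNIV. (c * x i) ^ Poly_Mapping.lookup m i)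
      = c ^ n * (\<Prod>i\<in>UNIV. x i ^ Poly_Mapping.lookup m i)" if "m \<in> Poly_Mapping.keys p" for m
  proof -
    have "(\<Sum>i\<in>UNIV. Poly_Mapping.lookup m i) = n"
      using assms that by (auto simp: homogeneous_def)
    then show ?thesis
      by (simp only: power_mult_distrib prod.distrib power_sum[symmetric])
  qed
  then show ?thesis
    unfolding eval_via_def by (simp add: sum_distrib_left mult.left_commute)
qed

end

interpretation to_ac: coeff_hom to_ac
  by unfold_locales simp_all

interpretation const: coeff_hom "\<lambda>c. [:c:]"
  by unfold_locales simp_all

lemma eval4_conv_eval_via: "eval4 p x = eval_via to_ac x p"
  by (simp add: eval4_def eval_via_def)

section \<open>Calculus of homogeneous polynomials\<close>

lemma homogeneous_0 [simp]: "homogeneous n 0"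
  by (simp add: homogeneous_def)

lemma homogeneous_1 [simp]: "homogeneous 0 1"
  by (simp add: homogeneous_def)

lemma homogeneous_add: "homogeneous n p \<Longrightarrow> homogeneous n q \<Longrightarrow> homogeneous n (p + q)"
  using Poly_Mapping.keys_add[of p q] by (auto simp: homogeneous_def)

lemma homogeneous_single:
  "(\<Sum>i\<in>UNIV. Poly_Mapping.lookup m i) = n \<Longrightarrow> homogeneous n (Poly_Mapping.single m c)"
  by (auto simp: homogeneous_def)

lemma homogeneous_sum:
  "(\<And>a. a \<in> A \<Longrightarrow> homogeneous n (g a)) \<Longrightarrow> homogeneous n (\<Sum>a\<in>A. g a)"
  by (induction A rule: infinite_finite_induct) (auto intro: homogeneous_add)

lemma homogeneous_mult:
  assumes "homogeneous m p" "homogeneous n q"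
  shows "homogeneous (m + n) (p * q)"
  unfolding homogeneous_def
proof
  fix k assume "k \<in> Poly_Mapping.keys (p * q)"
  then obtain a b where "k = a + b" "a \<in> Poly_Mapping.keys p" "b \<in> Poly_Mapping.keys q"
    using keys_mult[of p q] by blast
  then show "(\<Sum>i\<in>UNIV. Poly_Mapping.lookup k i) = m + n"
    using assms by (simp add: homogeneous_def lookup_add sum.distrib)
qed

lemma homogeneous_const: "homogeneous 0 (Poly_Mapping.single 0 c)"
  by (auto simp: homogeneous_def)

lemma homogeneous_scale4: "homogeneous n p \<Longrightarrow> homogeneous n (scale4 c p)"
  using homogeneous_mult[OF homogeneous_const, of n p c] by (simp add: scale4_def)

lemma homogeneous_diff:
  assumes "homogeneous n p" "homogeneous n q" shows "homogeneous n (p - q)"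
proof -
  have *: "p - q = p + scale4 (- 1) q"
    by (simp add: scale4_def single_uminus)
  show ?thesis
    unfolding * by (intro homogeneous_add homogeneous_scale4 assms)
qed

lemma homogeneous_Var: "homogeneous 1 (Var i)"
  unfolding Var_def by (rule homogeneous_single) (simp add: lookup_single when_def)

lemma homogeneous_power: "homogeneous n p \<Longrightarrow> homogeneous (n * k) (p ^ k)"
  by (induction k) (simp_all add: homogeneous_mult)

lemma homogeneous_prod:
  "(\<And>a. a \<in> A \<Longrightarrow> homogeneous n (g a)) \<Longrightarrow> homogeneous (n * card A) (\<Prod>a\<in>A. g a)"
  by (induction A rule: infinite_finite_induct) (simp_all add: homogeneous_mult)

text \<open>Splitting off one variable is the induction step on the degree in
  \<open>point_ideal\<close>.\<close>

lemma monomial_Suc_cases: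
  assumes "(\<Sum>i\<in>UNIV. Poly_Mapping.lookup m i) = Suc n"
  obtains i m' where "\<And>c. Poly_Mapping.single m (c::'k::field) = Var i * Poly_Mapping.single m' c"
    and "(\<Sum>i\<in>UNIV. Poly_Mapping.lookup (m' :: 4 \<Rightarrow>\<^sub>0 nat) i) = n"
proof -
  obtain i where i: "Poly_Mapping.lookup m i \<noteq> 0"
    using assms by (metis Zero_not_Suc sum.neutral)
  define m' where "m' = m - Poly_Mapping.single i 1"
  have m: "m = Poly_Mapping.single i 1 + m'"
    using i by (intro poly_mapping_eqI)
      (auto simp: m'_def lookup_add lookup_minus lookup_single when_def)
  have "(\<Sum>j\<in>UNIV. Poly_Mapping.lookup m j) = Suc (\<Sum>j\<in>UNIV. Poly_Mapping.lookup m' j)"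
    by (simp add: m lookup_add sum.distrib lookup_single when_def)
  with assms have "(\<Sum>j\<in>UNIV. Poly_Mapping.lookup m' j) = n" by simp
  moreover have "Poly_Mapping.single m c = Var i * Poly_Mapping.single m' c" for c :: 'k
    by (simp add: m Var_def mult_single)
  ultimately show ?thesis using that by blast
qed

subsection \<open>Partial derivatives\<close>

text \<open>If the variable occurs in \<open>m\<close>, multiplication restores the lowered
  exponent; if not, the truncated exponent is wrong but both coefficients are 0.\<close>

lemma Var_mult_derivative_monomial:
  "Var i * Poly_Mapping.single (m - Poly_Mapping.single i 1) (of_nat (Poly_Mapping.lookup m i) * c)
     = Poly_Mapping.single m (of_nat (Poly_Mapping.lookup m i) * c)"
proof (cases "Poly_Mapping.lookup m i = 0")
  case False
  then have "Poly_Mapping.single i 1 + (m - Poly_Mapping.single i 1) = m"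
    by (intro poly_mapping_eqI) (auto simp: lookup_add lookup_minus lookup_single when_def)
  then show ?thesis by (simp add: Var_def mult_single)
qed simp

text \<open>Each monomial gets multiplied by the sum of its exponents, which is
  \<open>d\<close>.\<close>

lemma euler_formula:
  assumes "homogeneous d f"
  shows "(\<Sum>i\<in>UNIV. Var i * partial_deriv i f) = scale4 (of_nat d) f"
proof -
  have "(\<Sum>i\<in>UNIV. Var i * partial_deriv i f) = (\<Sum>m\<in>Poly_Mapping.keys f. \<Sum>i\<in>UNIV.
      Poly_Mapping.single m (of_nat (Poly_Mapping.lookup m i) * Poly_Mapping.lookup f m))"
    unfolding partial_deriv_def sum_distrib_left Var_mult_derivative_monomial
    by (rule sum.swap)
  also have "\<dots> = (\<Sum>m\<in>Poly_Mapping.keys f.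
      scale4 (of_nat d) (Poly_Mapping.single m (Poly_Mapping.lookup f m)))"
  proof (rule sum.cong[OF refl])
    fix m assume "m \<in> Poly_Mapping.keys f"
    then have "(\<Sum>i\<in>UNIV. Poly_Mapping.lookup m i) = d"
      using assms by (simp add: homogeneous_def)
    then have "scale4 (of_nat d) (Poly_Mapping.single m (Poly_Mapping.lookup f m)) =
       Poly_Mapping.single m ((\<Sum>i\<in>UNIV. of_nat (Poly_Mapping.lookup m i)) * Poly_Mapping.lookup f m)"
      by (simp add: scale4_def mult_single del: single_of_nat flip: of_nat_sum)
    also have "\<dots> = (\<Sum>i\<in>UNIV.
        Poly_Mapping.single m (of_nat (Poly_Mapping.lookup m i) * Poly_Mapping.lookup f m))"
      unfolding sum_distrib_right
      by (intro poly_mapping_eqI) (simp add: lookup_sum lookup_single when_def)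
    finally show "(\<Sum>i\<in>UNIV.
        Poly_Mapping.single m (of_nat (Poly_Mapping.lookup m i) * Poly_Mapping.lookup f m)) =
        scale4 (of_nat d) (Poly_Mapping.single m (Poly_Mapping.lookup f m))" ..
  qed
  also have "\<dots> = scale4 (of_nat d) f"
    by (simp add: scale4_def poly_mapping_sum_single flip: sum_distrib_left)
  finally show ?thesis .
qed

lemma homogeneous_partial_deriv:
  assumes "homogeneous d f"
  shows "homogeneous (d - 1) (partial_deriv i f)"
  unfolding partial_deriv_def
proof (rule homogeneous_sum)
  fix m assume m: "m \<in> Poly_Mapping.keys f"
  show "homogeneous (d - 1) (Poly_Mapping.single (m - Poly_Mapping.single i 1)
          (of_nat (Poly_Mapping.lookup m i) * Poly_Mapping.lookup f m))"
  proof (cases "Poly_Mapping.lookup m i = 0")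
    case False
    have "(\<Sum>j\<in>UNIV. Poly_Mapping.lookup (m - Poly_Mapping.single i 1) j) =
      (\<Sum>j\<in>UNIV. Poly_Mapping.lookup m j) - (\<Sum>j\<in>UNIV. Poly_Mapping.lookup (Poly_Mapping.single i 1) j)"
      unfolding lookup_minus using False
      by (intro sum_subtractf_nat) (auto simp: lookup_single when_def)
    also have "\<dots> = d - 1"
      using m assms by (simp add: homogeneous_def lookup_single when_def)
    finally show ?thesis by (rule homogeneous_single)
  qed simp
qed

text \<open>This is the restriction of a polynomial to the line \<open>y + T v\<close>. Its
  coefficients at 0 and 1 are the value at \<open>y\<close> and the derivative along
  \<open>v\<close>.\<close>

definition eval_line :: "(4 \<Rightarrow> 'k::field) \<Rightarrow> (4 \<Rightarrow> 'k) \<Rightarrow> 'k poly4 \<Rightarrow> 'k Polynomial.poly" where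
  "eval_line y v = eval_via (\<lambda>c. [:c:]) (\<lambda>i. [:y i, v i:])"

lemma smult_sum_right:
  "Polynomial.smult c (\<Sum>a\<in>A. g a) = (\<Sum>a\<in>A. Polynomial.smult c (g a))"
  by (induction A rule: infinite_finite_induct) (auto simp: smult_add_right)

text \<open>This is the chain rule along the line. Both sides are additive in \<open>f\<close>, so
  the product rule for a single monomial suffices.\<close>

lemma pderiv_eval_line:
  "pderiv (eval_line y v f) = (\<Sum>i\<in>UNIV. Polynomial.smult (v i) (eval_line y v (partial_deriv i f)))"
proof -
  let ?x = "\<lambda>i. [:y i, v i:]"
  have *: "pderiv (eval_line y v (Poly_Mapping.single m c)) = (\<Sum>i\<in>UNIV. Polynomial.smult (v i)
     (eval_line y v (Poly_Mapping.single (m - Poly_Mapping.single i 1)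
        (of_nat (Poly_Mapping.lookup m i) * c))))" for m c
  proof -
    \<comment> \<open>The cofactor of the \<open>i\<close>-th variable power is untouched when the
      exponent of that variable drops.\<close>
    let ?R = "\<lambda>i. \<Prod>j\<in>UNIV - {i}. ?x j ^ Poly_Mapping.lookup m j"
    have R: "(\<Prod>j\<in>UNIV. ?x j ^ Poly_Mapping.lookup (m - Poly_Mapping.single i 1) j) =
      ?x i ^ (Poly_Mapping.lookup m i - 1) * ?R i" for i
    proof -
      have "(\<Prod>j\<in>UNIV - {i}. ?x j ^ Poly_Mapping.lookup (m - Poly_Mapping.single i 1) j) = ?R i"
        by (rule prod.cong) (auto simp: lookup_minus lookup_single when_def)
      then show ?thesis
        using prod.remove[of UNIV i "\<lambda>j. ?x j ^ Poly_Mapping.lookup (m - Poly_Mapping.single i 1) j"]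
        by (simp add: lookup_minus)
    qed
    have "pderiv (eval_line y v (Poly_Mapping.single m c)) =
      (\<Sum>i\<in>UNIV. Polynomial.smult c (?R i * pderiv (?x i ^ Poly_Mapping.lookup m i)))"
      by (simp add: eval_line_def const.eval_via_single pderiv_smult pderiv_prod smult_sum_right)
    also have "\<dots> = (\<Sum>i\<in>UNIV. Polynomial.smult (v i)
     (eval_line y v (Poly_Mapping.single (m - Poly_Mapping.single i 1)
        (of_nat (Poly_Mapping.lookup m i) * c))))"
    proof (rule sum.cong[OF refl])
      fix i
      have "pderiv (?x i) = [:v i:]" by (simp add: pderiv_pCons)
      then show "Polynomial.smult c (?R i * pderiv (?x i ^ Poly_Mapping.lookup m i)) =
        Polynomial.smult (v i) (eval_line y v (Poly_Mapping.single (m - Poly_Mapping.single i 1)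
        (of_nat (Poly_Mapping.lookup m i) * c)))"
        unfolding eval_line_def const.eval_via_single R pderiv_power
        by (simp add: mult_ac)
    qed
    finally show ?thesis .
  qed
  have "pderiv (eval_line y v f) = pderiv (eval_line y v
      (\<Sum>m\<in>Poly_Mapping.keys f. Poly_Mapping.single m (Poly_Mapping.lookup f m)))"
    by (simp add: poly_mapping_sum_single)
  also have "\<dots> = (\<Sum>m\<in>Poly_Mapping.keys f.
      pderiv (eval_line y v (Poly_Mapping.single m (Poly_Mapping.lookup f m))))"
    by (simp add: eval_line_def const.eval_via_sum higher_pderiv_sum[of 1, simplified])
  also have "\<dots> = (\<Sum>i\<in>UNIV. Polynomial.smult (v i) (eval_line y v (partial_deriv i f)))"
    unfolding * unfolding partial_deriv_def eval_line_def const.eval_via_sum smult_sum_right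
    by (rule sum.swap)
  finally show ?thesis .
qed

subsection \<open>First-order jets along rational lines\<close>

lemma eval_line_0 [simp]: "eval_line y v 0 = 0"
  by (simp add: eval_line_def)

lemma eval_line_add: "eval_line y v (p + q) = eval_line y v p + eval_line y v q"
  and eval_line_diff: "eval_line y v (p - q) = eval_line y v p - eval_line y v q"
  and eval_line_mult: "eval_line y v (p * q) = eval_line y v p * eval_line y v q"
  and eval_line_sum: "eval_line y v (\<Sum>a\<in>A. g a) = (\<Sum>a\<in>A. eval_line y v (g a))"
  and eval_line_prod: "eval_line y v (\<Prod>a\<in>A. g a) = (\<Prod>a\<in>A. eval_line y v (g a))"
  and eval_line_power: "eval_line y v (p ^ n) = eval_line y v p ^ n"
  and eval_line_scale4: "eval_line y v (scale4 c p) = Polynomial.smult c (eval_line y v p)"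
  and eval_line_Var: "eval_line y v (Var i) = [:y i, v i:]"
  by (simp_all add: eval_line_def const.eval_via_add const.eval_via_diff const.eval_via_mult
      const.eval_via_sum const.eval_via_prod const.eval_via_power)

lemma eval4_to_ac: "eval4 p (\<lambda>i. to_ac (y i)) = to_ac (poly (eval_line y v p) 0)"
  by (simp add: eval4_def eval_line_def eval_via_def poly_sum poly_prod to_ac_sum to_ac_prod
      poly_power)

text \<open>Vanishing to second order is expressed as divisibility by the square of the parameter,
  which passes to sums and multiples at once.\<close>

lemma monom_2_dvd_iff:
  "Polynomial.monom 1 2 dvd p \<longleftrightarrow> Polynomial.coeff p 0 = 0 \<and> Polynomial.coeff p 1 = 0"
  by (auto simp: monom_1_dvd_iff' less_2_cases_iff)

text \<open>Translation by 1 permutes the field, so the sum of all elements does not change when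
  \<open>CARD('k)\<close> ones are added.\<close>

lemma of_nat_CARD_eq_0: "of_nat CARD('k) = (0 :: 'k::{field,finite})"
proof -
  have "(\<Sum>x\<in>UNIV. x) = (\<Sum>x\<in>UNIV. x + 1 :: 'k)"
    by (rule sum.reindex_bij_witness[of _ "\<lambda>x. x + 1" "\<lambda>x. x - 1"]) auto
  then show ?thesis by (simp add: sum.distrib)
qed

text \<open>Multiplication by a nonzero \<open>x\<close> permutes the nonzero elements; comparing
  their products gives \<open>x ^ (CARD('k) - 1) = 1\<close>.\<close>

lemma power_CARD_eq: "x ^ CARD('k) = (x :: 'k::{field,finite})"
proof (cases "x = 0")
  case False
  have "(\<Prod>z\<in>UNIV - {0}. z) = (\<Prod>z\<in>UNIV - {0}. x * z)"
    using False by (intro prod.reindex_bij_witness[of _ "\<lambda>z. x * z" "\<lambda>z. z / x"]) simp_all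
  then have "x ^ (CARD('k) - 1) = 1"
    by (simp add: prod.distrib card_Diff_singleton)
  then show ?thesis
    using power_minus_mult[of "CARD('k)" x] by simp
qed simp

text \<open>To first order the powers of the coordinates on the line are the constants
  \<open>y i\<close>. So the jet of the Frobenius form is the sum of the jets of the partial
  derivatives weighted by \<open>y i\<close>, and Euler's formula together with the chain rule makes
  it vanish.\<close>

lemma frobenius_form_jet:
  fixes f :: "'k::{field,finite} poly4"
  assumes "homogeneous d f" and f: "Polynomial.monom 1 2 dvd eval_line y v f"
  shows "Polynomial.monom 1 2 dvd eval_line y v (frobenius_form f)"
proof -
  let ?D = "\<lambda>i. eval_line y v (partial_deriv i f)"
  let ?c = Polynomial.coeff
  have c0: "?c (p * q) 0 = ?c p 0 * ?c q 0"
    and c1: "?c (p * q) 1 = ?c p 0 * ?c q 1 + ?c p 1 * ?c q 0" for p q :: "'k Polynomial.poly"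
    by (simp_all add: coeff_mult)
  have pow0: "?c ([:y i, v i:] ^ CARD('k)) 0 = y i" for i
    by (simp add: coeff_0_power power_CARD_eq)
  \<comment> \<open>The Frobenius map has zero differential, since the exponent is 0 in the
    field.\<close>
  have "pderiv ([:y i, v i:] ^ CARD('k)) = 0" for i
    by (simp add: pderiv_power of_nat_CARD_eq_0)
  then have pow1: "?c ([:y i, v i:] ^ CARD('k)) 1 = 0" for i
    using coeff_pderiv[of "[:y i, v i:] ^ CARD('k)" 0] by simp
  have lin1: "?c [:y i, v i:] 1 = v i" for i
    by simp
  have f0: "?c (eval_line y v f) 0 = 0" and f1: "?c (eval_line y v f) 1 = 0"
    using f by (simp_all add: monom_2_dvd_iff)
  have euler: "(\<Sum>i\<in>UNIV. [:y i, v i:] * ?D i) = Polynomial.smult (of_nat d) (eval_line y v f)"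
    using arg_cong[OF euler_formula[OF assms(1)], of "eval_line y v"]
    by (simp only: eval_line_sum eval_line_mult eval_line_Var eval_line_scale4)
  have "(\<Sum>i\<in>UNIV. y i * ?c (?D i) 0) = 0"
    using arg_cong[OF euler, of "\<lambda>p. ?c p 0"] f0 by (simp add: coeff_sum)
  \<comment> \<open>The linear coefficient of Euler's relation has two parts. The one with the
    factors \<open>v i\<close> is the derivative of \<open>f\<close> along \<open>v\<close>, which
    is 0, so the other vanishes too.\<close>
  moreover have "(\<Sum>i\<in>UNIV. y i * ?c (?D i) 1) = 0"
  proof -
    have "(\<Sum>i\<in>UNIV. v i * ?c (?D i) 0) = ?c (pderiv (eval_line y v f)) 0"
      by (simp add: pderiv_eval_line coeff_sum)
    also have "\<dots> = 0" using f1 by (simp add: coeff_pderiv)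
    finally show ?thesis
      using arg_cong[OF euler, of "\<lambda>p. ?c p 1"] f1
      by (simp add: coeff_sum sum.distrib c1 lin1 del: One_nat_def mult_pCons_left)
  qed
  moreover have "eval_line y v (frobenius_form f) = (\<Sum>i\<in>UNIV. [:y i, v i:] ^ CARD('k) * ?D i)"
    by (simp add: frobenius_form_def eval_line_sum eval_line_mult eval_line_power eval_line_Var)
  ultimately show ?thesis
    by (simp add: monom_2_dvd_iff coeff_sum c0 c1 pow0 pow1 del: One_nat_def)
qed

lemma homogeneous_frobenius_form:
  fixes f :: "'k::{field,finite} poly4"
  assumes "homogeneous d f"
  shows "homogeneous (CARD('k) + (d - 1)) (frobenius_form f)"
  unfolding frobenius_form_def
proof (rule homogeneous_sum)
  fix i
  have "homogeneous CARD('k) (Var i ^ CARD('k) :: 'k poly4)"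
    using homogeneous_power[OF homogeneous_Var] by simp
  then show "homogeneous (CARD('k) + (d - 1)) (Var i ^ CARD('k) * partial_deriv i f)"
    using homogeneous_partial_deriv[OF assms] homogeneous_mult by blast
qed

subsection \<open>Tangent directions\<close>

text \<open>
  Gaussian elimination and the determinant trick of Nakayama's lemma in one induction: below, \<open>I\<close> is
  the ideal of \<open>C\<close>, the linear forms \<open>a j\<close> cut out a rational point \<open>P\<close>, and \<open>e\<close> is evaluation at
  \<open>P\<close>.  Either \<open>C\<close> is the point \<open>P\<close>, or \<open>v\<close> is a tangent vector of \<open>C\<close> at \<open>P\<close>.
\<close>

lemma elimination:
  fixes a :: "4 \<Rightarrow> 'k::field poly4" and e :: "'k poly4 \<Rightarrow> 'k"
  assumes "finite S" and a: "\<And>j. homogeneous 1 (a j)"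
    and prime: "\<And>p q m n. homogeneous m p \<Longrightarrow> homogeneous n q \<Longrightarrow> p * q \<in> I \<Longrightarrow> p \<in> I \<or> q \<in> I"
    and I_0: "0 \<in> I" and I_add: "\<And>p q. p \<in> I \<Longrightarrow> q \<in> I \<Longrightarrow> p + q \<in> I"
    and I_diff: "\<And>p q. p \<in> I \<Longrightarrow> q \<in> I \<Longrightarrow> p - q \<in> I"
    and I_mult: "\<And>p q. q \<in> I \<Longrightarrow> p * q \<in> I"
    and e_diff: "\<And>p q. e (p - q) = e p - e q" and e_mult: "\<And>p q. e (p * q) = e p * e q"
    and e_I: "\<And>p. p \<in> I \<Longrightarrow> e p = 0"
    and G: "\<And>m. m \<in> G \<Longrightarrow> (\<exists>n. \<forall>j\<in>S. homogeneous n (m j)) \<and> (\<Sum>j\<in>S. m j * a j) \<in> I"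
  shows "(\<forall>j\<in>S. a j \<in> I) \<or> (\<exists>v. (\<exists>j\<in>S. v j \<noteq> 0) \<and> (\<forall>m\<in>G. (\<Sum>j\<in>S. v j * e (m j)) = 0))"
  using \<open>finite S\<close> G
proof (induction S arbitrary: G rule: finite_induct)
  case (insert r S)
  show ?case
  proof (cases "\<forall>m\<in>G. e (m r) = 0")
    case True
    \<comment> \<open>With no pivot in column \<open>r\<close>, the unit vector at \<open>r\<close>
      solves all equations.\<close>
    have "(\<Sum>j\<in>insert r S. (if j = r then 1 else 0) * e (m j)) = 0" if "m \<in> G" for m
      using True that insert.hyps by (auto intro!: sum.neutral)
    then show ?thesis
      by (intro disjI2 exI[of _ "\<lambda>j. if j = r then 1 else 0"]) auto
  next
    case False
    then obtain u where u: "u \<in> G" "e (u r) \<noteq> 0" by blast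
    \<comment> \<open>Cross-multiplication with the pivot relation \<open>u\<close> eliminates
      \<open>a r\<close> without division and keeps the coefficients of each relation homogeneous of
      a common degree.\<close>
    define G' where "G' = (\<lambda>m j. u r * m j - m r * u j) ` G"
    have "(\<forall>j\<in>S. a j \<in> I) \<or> (\<exists>v. (\<exists>j\<in>S. v j \<noteq> 0) \<and> (\<forall>m\<in>G'. (\<Sum>j\<in>S. v j * e (m j)) = 0))"
    proof (rule insert.IH)
      fix m' assume "m' \<in> G'"
      then obtain m where m: "m \<in> G" and m': "m' = (\<lambda>j. u r * m j - m r * u j)"
        by (auto simp: G'_def)
      obtain n1 n2 where n1: "\<forall>j\<in>insert r S. homogeneous n1 (m j)"
        and n2: "\<forall>j\<in>insert r S. homogeneous n2 (u j)"
        using insert.prems m u by meson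
      have "homogeneous (n2 + n1) (m' j)" if "j \<in> S" for j
        unfolding m' using that n1 n2
          homogeneous_mult[of n2 "u r" n1 "m j"] homogeneous_mult[of n1 "m r" n2 "u j"]
        by (intro homogeneous_diff) (auto simp: add.commute)
      moreover have "(\<Sum>j\<in>S. m' j * a j) =
          u r * (\<Sum>j\<in>insert r S. m j * a j) - m r * (\<Sum>j\<in>insert r S. u j * a j)"
        using insert.hyps
        by (simp add: m' algebra_simps sum_subtractf sum_distrib_left)
      moreover have "\<dots> \<in> I"
        using insert.prems m u I_diff I_mult by meson
      ultimately show "(\<exists>n. \<forall>j\<in>S. homogeneous n (m' j)) \<and> (\<Sum>j\<in>S. m' j * a j) \<in> I"
        by auto
    qed
    then show ?thesis
    proof
      \<comment> \<open>The pivot relation now gives \<open>u r * a r \<in> I\<close>. As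
        \<open>u r\<close> does not vanish at the point, it is not in \<open>I\<close>, and
        primality yields \<open>a r \<in> I\<close>.\<close>
      assume *: "\<forall>j\<in>S. a j \<in> I"
      have I_sum: "(\<Sum>j\<in>T. u j * a j) \<in> I" if "T \<subseteq> S" for T
        using finite_subset[OF that insert.hyps(1)] that
      proof (induction T rule: finite_induct)
        case (insert t T)
        then have "u t * a t \<in> I" "(\<Sum>j\<in>T. u j * a j) \<in> I" using * I_mult by auto
        then show ?case using insert.hyps by (simp add: I_add)
      qed (simp add: I_0)
      have "u r * a r = (\<Sum>j\<in>insert r S. u j * a j) - (\<Sum>j\<in>S. u j * a j)"
        using insert.hyps by simp
      then have "u r * a r \<in> I"
        using I_diff[OF conjunct2[OF insert.prems[OF u(1)]] I_sum[OF subset_refl]] by simp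
      moreover have "u r \<notin> I" using u(2) e_I by blast
      ultimately have "a r \<in> I"
        using prime a insert.prems[OF u(1)] by blast
      with * show ?thesis by simp
    next
      assume "\<exists>v. (\<exists>j\<in>S. v j \<noteq> 0) \<and> (\<forall>m\<in>G'. (\<Sum>j\<in>S. v j * e (m j)) = 0)"
      then obtain v i where v: "i \<in> S" "v i \<noteq> 0" "\<And>m. m \<in> G' \<Longrightarrow> (\<Sum>j\<in>S. v j * e (m j)) = 0"
        by blast
      \<comment> \<open>Back substitution: the entry at \<open>r\<close> is chosen to solve the
        pivot equation, and scaling the other entries by \<open>e (u r)\<close> clears the
        denominator.\<close>
      define w where "w j = (if j = r then - (\<Sum>j\<in>S. v j * e (u j)) else e (u r) * v j)" for j
      have "(\<Sum>j\<in>insert r S. w j * e (m j)) = 0" if "m \<in> G" for m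
      proof -
        have "0 = (\<Sum>j\<in>S. v j * (e (u r) * e (m j) - e (m r) * e (u j)))"
          using v(3)[of "\<lambda>j. u r * m j - m r * u j"] that by (simp add: G'_def e_diff e_mult)
        also have "\<dots> = (\<Sum>j\<in>S. e (u r) * v j * e (m j)) - (\<Sum>j\<in>S. v j * e (u j)) * e (m r)"
          by (simp add: right_diff_distrib sum_subtractf sum_distrib_left sum_distrib_right mult_ac)
        also have "(\<Sum>j\<in>S. e (u r) * v j * e (m j)) = (\<Sum>j\<in>S. w j * e (m j))"
          using insert.hyps by (intro sum.cong) (auto simp: w_def)
        finally show ?thesis
          using insert.hyps by (simp add: w_def)
      qed
      moreover have "w i \<noteq> 0" using v u insert.hyps by (auto simp: w_def)
      ultimately show ?thesis using v(1) by blast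
    qed
  qed
qed simp

section \<open>The ideal of a rational point\<close>

lemma scale4_mult_scale4: "scale4 a p * scale4 c q = scale4 (a * c) (p * q)"
proof -
  have "scale4 (a * c) (p * q) = (Poly_Mapping.single 0 a * Poly_Mapping.single 0 c) * (p * q)"
    by (simp add: scale4_def mult_single)
  then show ?thesis by (simp only: scale4_def mult_ac)
qed

text \<open>Modulo the linear forms every variable is a multiple of \<open>Var s\<close>, so a form
  of degree \<open>n\<close> reduces to a multiple of \<open>Var s ^ n\<close>. The homogeneous
  cofactors are what \<open>elimination\<close> requires.\<close>

lemma point_ideal:
  fixes g :: "'k::field poly4"
  assumes "y s = 1" "homogeneous n g"
  obtains c m where "\<And>j. homogeneous (n - 1) (m j)" and
    "g = scale4 c (Var s ^ n) + (\<Sum>j\<in>UNIV. m j * (Var j - scale4 (y j) (Var s)))"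
proof -
  let ?a = "\<lambda>j. Var j - scale4 (y j) (Var s) :: 'k poly4"
  \<comment> \<open>The clause for \<open>n = 0\<close> guards against the truncated
    \<open>n - 1\<close>: a nonzero constant cofactor there would have the wrong degree after
    multiplication by \<open>Var s\<close>.\<close>
  define D where "D n g \<longleftrightarrow> (\<exists>c m. (\<forall>j. homogeneous (n - 1) (m j)) \<and> (n = 0 \<longrightarrow> m = (\<lambda>_. 0)) \<and>
     g = scale4 c (Var s ^ n) + (\<Sum>j\<in>UNIV. m j * ?a j))" for n g
  have D_0: "D n 0" for n
    unfolding D_def by (intro exI[of _ 0] exI[of _ "\<lambda>_. 0"]) (auto simp: scale4_def)
  have D_add: "D n (p + q)" if p: "D n p" and q: "D n q" for n p q
  proof -
    obtain c m where p': "\<forall>j. homogeneous (n - 1) (m j)" "n = 0 \<longrightarrow> m = (\<lambda>_. 0)"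
      "p = scale4 c (Var s ^ n) + (\<Sum>j\<in>UNIV. m j * ?a j)"
      using p unfolding D_def by (elim exE conjE) (rule that)
    obtain c' m' where q':
      "\<forall>j. homogeneous (n - 1) (m' j)" "n = 0 \<longrightarrow> m' = (\<lambda>_. 0)"
      "q = scale4 c' (Var s ^ n) + (\<Sum>j\<in>UNIV. m' j * ?a j)"
      using q unfolding D_def by (elim exE conjE) (rule that)
    note * = p' q'
    have "p + q = scale4 (c + c') (Var s ^ n) + (\<Sum>j\<in>UNIV. (m j + m' j) * ?a j)"
      unfolding *(3,6) by (simp add: scale4_def single_add distrib_right sum.distrib)
    moreover have "\<forall>j. homogeneous (n - 1) (m j + m' j)"
      using * homogeneous_add by blast
    moreover have "n = 0 \<longrightarrow> (\<lambda>j. m j + m' j) = (\<lambda>_. 0)" using * by auto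
    ultimately show ?thesis
      unfolding D_def by (intro exI[of _ "c + c'"] exI[of _ "\<lambda>j. m j + m' j"] conjI)
  qed
  have D_Var: "D (Suc n) (Var i * g)" if "homogeneous n g" and "D n g" for n g i
  proof -
    obtain c m where *: "\<forall>j. homogeneous (n - 1) (m j)" "n = 0 \<longrightarrow> m = (\<lambda>_. 0)"
      and g: "g = scale4 c (Var s ^ n) + (\<Sum>j\<in>UNIV. m j * ?a j)"
      using \<open>D n g\<close> unfolding D_def by (elim exE conjE) (rule that)
    define m' where "m' j = scale4 (y i) (Var s * m j) + (if j = i then g else 0)" for j
    \<comment> \<open>Replacing \<open>Var i\<close> by \<open>y i\<close> times
      \<open>Var s\<close> costs an error \<open>g * ?a i\<close>, which joins the cofactor at
      \<open>i\<close>.\<close>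
    have "Var i * g = scale4 (y i) (Var s) * g + g * ?a i"
      by (simp add: algebra_simps)
    also have "scale4 (y i) (Var s) * g = scale4 (y i * c) (Var s ^ Suc n) +
        (\<Sum>j\<in>UNIV. scale4 (y i) (Var s * m j) * ?a j)"
    proof -
      have "scale4 (y i) (Var s) * scale4 c (Var s ^ n) = scale4 (y i * c) (Var s ^ Suc n)"
        by (simp add: scale4_mult_scale4)
      moreover have "scale4 (y i) (Var s) * (m j * ?a j) = scale4 (y i) (Var s * m j) * ?a j" for j
        by (simp add: scale4_def mult_ac)
      ultimately show ?thesis
        using arg_cong[OF g, of "\<lambda>p. scale4 (y i) (Var s) * p"]
        by (simp only: distrib_left sum_distrib_left)
    qed
    also have "g * ?a i = (\<Sum>j\<in>UNIV. (if j = i then g else 0) * ?a j)"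
    proof -
      have "(\<Sum>j\<in>UNIV. (if j = i then g else 0) * ?a j) = (\<Sum>j\<in>UNIV. if j = i then g * ?a j else 0)"
        by (intro sum.cong) auto
      then show ?thesis by simp
    qed
    finally have "Var i * g = scale4 (y i * c) (Var s ^ Suc n) + (\<Sum>j\<in>UNIV. m' j * ?a j)"
      by (simp only: m'_def distrib_right sum.distrib add.assoc)
    moreover have "homogeneous n (m' j)" for j
    proof -
      have "homogeneous n (Var s * m j)"
      proof (cases n)
        case (Suc k)
        then show ?thesis using homogeneous_mult[OF homogeneous_Var, of k "m j" s] * by simp
      qed (use * in simp)
      then show ?thesis
        using \<open>homogeneous n g\<close> unfolding m'_def by (intro homogeneous_add homogeneous_scale4) auto
    qed
    ultimately show ?thesis
      unfolding D_def by (intro exI[of _ "y i * c"] exI[of _ m'] conjI) simp_all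
  qed
  have D_single: "D n (Poly_Mapping.single m c)"
    if "(\<Sum>i\<in>UNIV. Poly_Mapping.lookup m i) = n" for n m c
    using that
  proof (induction n arbitrary: m)
    case 0
    then have "m = 0" by (intro poly_mapping_eqI) simp
    then show ?case
      unfolding D_def by (intro exI[of _ c] exI[of _ "\<lambda>_. 0"]) (simp add: scale4_def)
  next
    case (Suc n)
    then obtain i m' where "\<And>c. Poly_Mapping.single m (c::'k) = Var i * Poly_Mapping.single m' c"
      and m': "(\<Sum>i\<in>UNIV. Poly_Mapping.lookup m' i) = n"
      by (metis monomial_Suc_cases)
    then show ?case using D_Var[OF homogeneous_single[OF m'] Suc.IH[OF m']] by simp
  qed
  have "D n (\<Sum>m\<in>A. Poly_Mapping.single m (Poly_Mapping.lookup g m))"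
    if "A \<subseteq> Poly_Mapping.keys g" for A
  proof -
    have "finite A" using that finite_subset finite_keys by blast
    then show ?thesis using that
    proof (induction A rule: finite_induct)
      case (insert m A)
      then have "D n (Poly_Mapping.single m (Poly_Mapping.lookup g m))"
        using assms(2) by (intro D_single) (auto simp: homogeneous_def)
      with insert show ?case by (simp add: D_add)
    qed (simp add: D_0)
  qed
  from this[OF subset_refl] have "D n g" by (simp add: poly_mapping_sum_single)
  then show thesis unfolding D_def by (elim exE conjE) (rule that, auto)
qed

subsection \<open>The homogeneous ideal of a variety\<close>

definition ideal_of :: "'k::field point set \<Rightarrow> 'k poly4 set" where
  "ideal_of Z = {p. \<forall>x. x \<noteq> (\<lambda>_. 0) \<and> proj_point x \<in> Z \<longrightarrow> eval4 p x = 0}"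

lemma vanishing_forms_iff: "p \<in> vanishing_forms Z n \<longleftrightarrow> homogeneous n p \<and> p \<in> ideal_of Z"
  by (simp add: vanishing_forms_def forms_def ideal_of_def)

lemma ideal_of_0: "0 \<in> ideal_of Z"
  and ideal_of_add: "p \<in> ideal_of Z \<Longrightarrow> q \<in> ideal_of Z \<Longrightarrow> p + q \<in> ideal_of Z"
  and ideal_of_diff: "p \<in> ideal_of Z \<Longrightarrow> q \<in> ideal_of Z \<Longrightarrow> p - q \<in> ideal_of Z"
  and ideal_of_mult: "q \<in> ideal_of Z \<Longrightarrow> p * q \<in> ideal_of Z"
  and ideal_of_scale4: "q \<in> ideal_of Z \<Longrightarrow> scale4 c q \<in> ideal_of Z"
  by (simp_all add: ideal_of_def eval4_conv_eval_via to_ac.eval_via_add to_ac.eval_via_diff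
      to_ac.eval_via_mult)

lemma proj_point_eqD:
  assumes "proj_point x = proj_point y"
  obtains c where "c \<noteq> 0" "x = (\<lambda>i. c * y i)"
proof -
  have "x \<in> proj_point x" by (auto simp: proj_point_def intro!: exI[of _ 1])
  then have "x \<in> proj_point y" by (simp only: assms)
  then show thesis using that by (auto simp: proj_point_def)
qed

lemma proj_point_scale:
  assumes "c \<noteq> 0" shows "proj_point (\<lambda>i. c * x i) = proj_point x"
proof -
  have "\<exists>b. (\<lambda>i. a * x i) = (\<lambda>i. b * (c * x i)) \<and> b \<noteq> 0" if "a \<noteq> 0" for a
    using assms that by (intro exI[of _ "a / c"]) simp
  moreover have "\<exists>b. (\<lambda>i. a * (c * x i)) = (\<lambda>i. b * x i) \<and> b \<noteq> 0" if "a \<noteq> 0" for a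
    using assms that by (intro exI[of _ "a * c"]) (simp add: mult.assoc)
  ultimately show ?thesis
    unfolding proj_point_def by blast
qed

text \<open>Homogeneity makes vanishing independent of the chosen coordinate vector.\<close>

lemma in_zero_locus_iff:
  assumes "\<forall>g\<in>G. \<exists>n. homogeneous n g" "x \<noteq> (\<lambda>_. 0)"
  shows "proj_point x \<in> zero_locus G \<longleftrightarrow> (\<forall>g\<in>G. eval4 g x = 0)"
proof
  assume "proj_point x \<in> zero_locus G"
  then obtain y where y: "proj_point x = proj_point y" "\<forall>g\<in>G. eval4 g y = 0"
    unfolding zero_locus_def by blast
  then obtain c where "x = (\<lambda>i. c * y i)" by (elim proj_point_eqD)
  then show "\<forall>g\<in>G. eval4 g x = 0"
    using y(2) assms(1) to_ac.eval_via_homogeneous[of _ _ c y]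
    by (fastforce simp: eval4_conv_eval_via)
qed (use assms(2) in \<open>auto simp: zero_locus_def\<close>)

lemma zariski_closed_points:
  assumes "zariski_closed Z" "P \<in> Z"
  obtains x where "x \<noteq> (\<lambda>_. 0)" "P = proj_point x"
  using assms by (auto simp: zariski_closed_def zero_locus_def)

lemma subset_zero_locus_iff:
  assumes "zariski_closed Z" "\<forall>g\<in>G. \<exists>n. homogeneous n g"
  shows "Z \<subseteq> zero_locus G \<longleftrightarrow> G \<subseteq> ideal_of Z"
proof
  assume "Z \<subseteq> zero_locus G"
  then show "G \<subseteq> ideal_of Z"
    using in_zero_locus_iff[OF assms(2)] by (fastforce simp: ideal_of_def)
next
  assume G: "G \<subseteq> ideal_of Z"
  show "Z \<subseteq> zero_locus G"
  proof
    fix P assume "P \<in> Z"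
    then obtain x where "x \<noteq> (\<lambda>_. 0)" "P = proj_point x"
      using zariski_closed_points[OF assms(1)] by blast
    then show "P \<in> zero_locus G"
      using G \<open>P \<in> Z\<close> in_zero_locus_iff[OF assms(2)] by (auto simp: ideal_of_def)
  qed
qed

text \<open>If \<open>p * q\<close> vanishes on \<open>C\<close>, then \<open>C\<close> is covered
  by the zero loci of \<open>p\<close> and \<open>q\<close>. These are closed by homogeneity, and
  irreducibility puts \<open>C\<close> inside one of them.\<close>

lemma ideal_of_prime:
  assumes "irreducible_variety C" "homogeneous m p" "homogeneous n q" "p * q \<in> ideal_of C"
  shows "p \<in> ideal_of C \<or> q \<in> ideal_of C"
proof -
  have C: "zariski_closed C" using assms by (simp add: irreducible_variety_def)
  have p: "\<forall>g\<in>{p}. \<exists>n. homogeneous n g" and q: "\<forall>g\<in>{q}. \<exists>n. homogeneous n g"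
    using assms by auto
  have "C \<subseteq> zero_locus {p} \<union> zero_locus {q}"
  proof
    fix P assume "P \<in> C"
    then obtain x where x: "x \<noteq> (\<lambda>_. 0)" "P = proj_point x"
      using zariski_closed_points[OF C] by blast
    then have "eval4 p x * eval4 q x = 0"
      using assms(4) \<open>P \<in> C\<close> by (simp add: ideal_of_def eval4_conv_eval_via to_ac.eval_via_mult)
    then show "P \<in> zero_locus {p} \<union> zero_locus {q}"
      using x in_zero_locus_iff[OF p x(1)] in_zero_locus_iff[OF q x(1)] by auto
  qed
  moreover have "zariski_closed (zero_locus {p})" "zariski_closed (zero_locus {q})"
    using p q unfolding zariski_closed_def by blast+
  ultimately have "C \<subseteq> zero_locus {p} \<or> C \<subseteq> zero_locus {q}"
    using assms(1) unfolding irreducible_variety_def by blast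
  then show ?thesis
    using subset_zero_locus_iff[OF C p] subset_zero_locus_iff[OF C q] by auto
qed

text \<open>In the chart where coordinate \<open>s\<close> is 1, tangency is a system of linear
  equations, one for each way to write an element of the ideal through the linear forms cutting out
  the point. By \<open>elimination\<close> it has a nonzero solution unless all these forms vanish
  on \<open>C\<close>, which would leave only the point.\<close>

lemma tangent_direction:
  fixes C :: "'k::field point set"
  assumes C: "irreducible_variety C" and P: "proj_point (\<lambda>i. to_ac (y i)) \<in> C"
    and s: "y s = 1" and not_single: "C \<noteq> {proj_point (\<lambda>i. to_ac (y i))}"
  obtains v j where "v s = 0" "v j \<noteq> 0"
    and "\<And>n g. g \<in> vanishing_forms C n \<Longrightarrow> Polynomial.monom 1 2 dvd eval_line y v g"
proof -
  define a :: "4 \<Rightarrow> 'k poly4" where "a j = Var j - scale4 (y j) (Var s)" for j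
  define e where "e p = poly (eval_line y (\<lambda>_. 0) p) 0" for p :: "'k poly4"
  have e: "poly (eval_line y v p) 0 = e p" for v p
    unfolding e_def using eval4_to_ac by (metis to_ac_eq_iff)
  have y0: "(\<lambda>i. to_ac (y i)) \<noteq> (\<lambda>_. 0)"
    using s by (metis to_ac_eq_0_iff zero_neq_one)
  have e_I: "e p = 0" if "p \<in> ideal_of C" for p
    using that P y0 eval4_to_ac[of p y] by (auto simp: ideal_of_def e_def)
  \<comment> \<open>The index \<open>s\<close> is left out because \<open>a s = 0\<close>.\<close>
  define G where "G = {m. (\<exists>n. \<forall>j\<in>-{s}. homogeneous n (m j)) \<and> (\<Sum>j\<in>-{s}. m j * a j) \<in> ideal_of C}"
  have "(\<forall>j\<in>-{s}. a j \<in> ideal_of C) \<or>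
      (\<exists>v. (\<exists>j\<in>-{s}. v j \<noteq> 0) \<and> (\<forall>m\<in>G. (\<Sum>j\<in>-{s}. v j * e (m j)) = 0))"
  proof (rule elimination)
    show "homogeneous 1 (a j)" for j
      unfolding a_def by (intro homogeneous_diff homogeneous_scale4 homogeneous_Var)
    show "p \<in> ideal_of C \<or> q \<in> ideal_of C"
      if "homogeneous m p" "homogeneous n q" "p * q \<in> ideal_of C" for p q m n
      using ideal_of_prime[OF C that] .
  qed (auto simp: ideal_of_0 ideal_of_add ideal_of_diff ideal_of_mult e_I G_def,
      simp_all add: e_def eval_line_diff eval_line_mult)
  then show thesis
  proof
    assume a_C: "\<forall>j\<in>-{s}. a j \<in> ideal_of C"
    have "Q = proj_point (\<lambda>i. to_ac (y i))" if Q: "Q \<in> C" for Q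
    proof -
      obtain x where x: "x \<noteq> (\<lambda>_. 0)" "Q = proj_point x"
        using zariski_closed_points[OF _ Q] C by (auto simp: irreducible_variety_def)
      have x_eq: "x i = x s * to_ac (y i)" for i
      proof (cases "i = s")
        case False
        then have "eval4 (a i) x = 0" using a_C x Q by (auto simp: ideal_of_def)
        then show ?thesis
          by (simp add: a_def eval4_conv_eval_via to_ac.eval_via_diff mult.commute)
      qed (simp add: s)
      then have "x s \<noteq> 0" using x(1) by (metis mult_zero_left)
      have "x = (\<lambda>i. x s * to_ac (y i))" using x_eq by blast
      then have "Q = proj_point (\<lambda>i. x s * to_ac (y i))" using x(2) by simp
      then show ?thesis using proj_point_scale[OF \<open>x s \<noteq> 0\<close>] by simp
    qed
    with P have "C = {proj_point (\<lambda>i. to_ac (y i))}" by blast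
    with not_single show thesis by contradiction
  next
    assume "\<exists>v. (\<exists>j\<in>-{s}. v j \<noteq> 0) \<and> (\<forall>m\<in>G. (\<Sum>j\<in>-{s}. v j * e (m j)) = 0)"
    then obtain w j where w: "j \<noteq> s" "w j \<noteq> 0" "\<And>m. m \<in> G \<Longrightarrow> (\<Sum>j\<in>-{s}. w j * e (m j)) = 0"
      by auto
    \<comment> \<open>Entry 0 at \<open>s\<close> keeps the line in the chart: there
      \<open>Var s\<close> restricts to 1 and \<open>a i\<close> to \<open>v i\<close> times the
      parameter.\<close>
    define v where "v = w(s := 0)"
    have vs: "v s = 0" and vj: "v j \<noteq> 0" using w by (auto simp: v_def)
    have line_a: "eval_line y v (a i) = [:0, v i:]" for i
      by (simp add: a_def eval_line_diff eval_line_scale4 eval_line_Var s vs)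
    have "Polynomial.monom 1 2 dvd eval_line y v g" if "g \<in> vanishing_forms C n" for n g
    proof -
      have g: "homogeneous n g" "g \<in> ideal_of C" using that by (simp_all add: vanishing_forms_iff)
      obtain c m where m: "\<And>j. homogeneous (n - 1) (m j)"
        and g_eq: "g = scale4 c (Var s ^ n) + (\<Sum>j\<in>UNIV. m j * a j)"
        by (rule point_ideal[of y s, OF s g(1)]) (rule that[unfolded a_def])
      have line_g: "eval_line y v g = [:c:] + (\<Sum>j\<in>UNIV. eval_line y v (m j) * [:0, v j:])"
        unfolding g_eq
        by (simp add: eval_line_add eval_line_sum eval_line_mult eval_line_scale4 eval_line_power
            eval_line_Var line_a s vs del: mult_pCons_right)
      \<comment> \<open>All \<open>a j\<close> vanish at the point, so only the pure power
        contributes to the value of \<open>g\<close>.\<close>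
      have "c = e g"
        by (simp add: line_g poly_sum flip: e[of v])
      then have c: "c = 0" using e_I g by simp
      have "a s = 0" by (simp add: a_def s scale4_def)
      then have "g = (\<Sum>j\<in>-{s}. m j * a j)"
        by (simp add: g_eq c scale4_def Compl_eq_Diff_UNIV sum.remove[of UNIV s])
      then have "m \<in> G" using m g by (auto simp: G_def)
      then have "(\<Sum>j\<in>-{s}. w j * e (m j)) = 0" by (rule w)
      also have "(\<Sum>j\<in>-{s}. w j * e (m j)) = (\<Sum>j\<in>-{s}. v j * e (m j))"
        by (intro sum.cong) (auto simp: v_def)
      finally have "(\<Sum>j\<in>UNIV. v j * e (m j)) = 0"
        by (simp add: vs Compl_eq_Diff_UNIV sum.remove[of UNIV s])
      then have "Polynomial.coeff (eval_line y v g) 1 = 0"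
        by (simp add: line_g c coeff_sum mult.commute flip: e[of v] poly_0_coeff_0)
      moreover have "Polynomial.coeff (eval_line y v g) 0 = 0"
        by (simp add: line_g c coeff_sum)
      ultimately show ?thesis by (simp add: monom_2_dvd_iff)
    qed
    with vs vj show thesis using that by blast
  qed
qed

lemma rational_points_normalised:
  assumes "P \<in> rational_points C"
  obtains y s where "P = proj_point (\<lambda>i. to_ac (y i))" "y s = 1"
proof -
  obtain z where z: "z \<noteq> (\<lambda>_. 0)" "P = proj_point (\<lambda>i. to_ac (z i))"
    using assms by (auto simp: rational_points_def)
  then obtain s where s: "z s \<noteq> 0" by auto
  have "proj_point (\<lambda>i. to_ac (z i / z s)) = proj_point (\<lambda>i. to_ac (inverse (z s)) * to_ac (z i))"
    by (simp add: field_simps flip: to_ac_mult)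
  also have "\<dots> = P"
    using s z(2) by (intro trans[OF proj_point_scale]) auto
  finally show thesis using that[of "\<lambda>i. z i / z s" s] s by simp
qed

subsection \<open>Counting forms\<close>

interpretation poly4: vector_space scale4
  by (rule vector_space_scale4)

text \<open>Adjoining an independent \<open>b\<close> multiplies the size of the span by
  \<open>CARD('k)\<close>, since the coefficient of \<open>b\<close> is uniquely determined.\<close>

lemma card_poly4_span:
  fixes B :: "'k::{field,finite} poly4 set"
  assumes "finite B" "poly4.independent B"
  shows "card (poly4.span B) = CARD('k) ^ card B"
  using assms
proof (induction B rule: finite_induct)
  case (insert b B)
  let ?f = "\<lambda>(c, p). scale4 c b + p"
  have b: "b \<notin> poly4.span B" and B: "poly4.independent B"
    using insert by (auto simp: poly4.independent_insert)
  have "inj_on ?f (UNIV \<times> poly4.span B)"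
  proof (rule inj_onI, clarify)
    fix c p c' p'
    assume p: "p \<in> poly4.span B" "p' \<in> poly4.span B" and eq: "scale4 c b + p = scale4 c' b + p'"
    then have "scale4 (c - c') b = p' - p"
      by (simp add: poly4.scale_left_diff_distrib algebra_simps)
    then have "scale4 (c - c') b \<in> poly4.span B" using p poly4.span_diff by simp
    then have "scale4 (inverse (c - c')) (scale4 (c - c') b) \<in> poly4.span B"
      by (rule poly4.span_scale)
    then have "c = c'" using b by (cases "c = c'") (simp_all del: poly4.scale_eq_0_iff)
    then show "c = c' \<and> p = p'" using eq by simp
  qed
  moreover have "?f ` (UNIV \<times> poly4.span B) = poly4.span (insert b B)"
  proof (intro equalityI subsetI)
    fix p assume "p \<in> poly4.span (insert b B)"
    then obtain c where "p - scale4 c b \<in> poly4.span B"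
      by (auto simp: poly4.span_insert)
    then show "p \<in> ?f ` (UNIV \<times> poly4.span B)"
      by (intro image_eqI[of _ _ "(c, p - scale4 c b)"]) auto
  next
    fix p assume "p \<in> ?f ` (UNIV \<times> poly4.span B)"
    then obtain c q where "p = scale4 c b + q" "q \<in> poly4.span B" by auto
    then show "p \<in> poly4.span (insert b B)"
      by (auto simp: poly4.span_insert intro!: exI[of _ c])
  qed
  ultimately have "card (poly4.span (insert b B)) = card (UNIV \<times> poly4.span B :: ('k \<times> _) set)"
    by (metis card_image)
  then show ?case using insert B by (simp add: card_cartesian_product)
qed simp

lemma card_poly4_subspace:
  fixes V :: "'k::{field,finite} poly4 set"
  assumes "finite V" "poly4.subspace V"
  shows "card V = CARD('k) ^ poly4.dim V"
proof -
  obtain B where B: "B \<subseteq> V" "poly4.independent B" "V \<subseteq> poly4.span B" "card B = poly4.dim V"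
    using poly4.basis_exists by blast
  then have "poly4.span B = V" using assms(2) poly4.span_subspace by blast
  then show ?thesis
    using card_poly4_span[of B] B assms(1) finite_subset by metis
qed

text \<open>The translates of the kernel by the multiples of \<open>g\<close> lie in
  \<open>V\<close> and are disjoint, as \<open>\<psi>\<close> tells them apart.\<close>

lemma card_kernel_le:
  fixes V :: "'k::{field,finite} poly4 set"
  assumes V: "finite V" "poly4.subspace V" and "g \<in> V" "\<psi> g \<noteq> (0::'k)"
    and add: "\<And>p q. \<psi> (p + q) = \<psi> p + \<psi> q" and scale: "\<And>c p. \<psi> (scale4 c p) = c * \<psi> p"
  shows "CARD('k) * card {p \<in> V. \<psi> p = 0} \<le> card V"
proof -
  let ?f = "\<lambda>(c, p). scale4 c g + p"
  have "inj_on ?f (UNIV \<times> {p \<in> V. \<psi> p = 0})"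
  proof (rule inj_onI, clarify)
    fix c p c' p' assume "\<psi> p = 0" "\<psi> p' = 0" and eq: "scale4 c g + p = scale4 c' g + p'"
    have "c = c'"
      using arg_cong[OF eq, of \<psi>] \<open>\<psi> p = 0\<close> \<open>\<psi> p' = 0\<close> \<open>\<psi> g \<noteq> 0\<close> by (simp add: add scale)
    then show "c = c' \<and> p = p'" using eq by simp
  qed
  moreover have "?f ` (UNIV \<times> {p \<in> V. \<psi> p = 0}) \<subseteq> V"
    using \<open>g \<in> V\<close> V(2) by (auto intro: poly4.subspace_add poly4.subspace_scale)
  ultimately have "card (UNIV \<times> {p \<in> V. \<psi> p = 0} :: ('k \<times> _) set) \<le> card V"
    using V(1) card_inj_on_le by blast
  then show ?thesis by (simp add: card_cartesian_product)
qed

lemma finite_forms: "finite (forms n :: 'k::{field,finite} poly4 set)"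
proof -
  let ?M = "{m :: 4 \<Rightarrow>\<^sub>0 nat. (\<Sum>i\<in>UNIV. Poly_Mapping.lookup m i) = n}"
  have "Poly_Mapping.lookup ` ?M \<subseteq> {x. \<forall>i. (i \<in> UNIV \<longrightarrow> x i \<in> {..n}) \<and> (i \<notin> UNIV \<longrightarrow> x i = 0)}"
    by (auto intro: member_le_sum)
  moreover have "finite {x :: 4 \<Rightarrow> nat. \<forall>i. (i \<in> UNIV \<longrightarrow> x i \<in> {..n}) \<and> (i \<notin> UNIV \<longrightarrow> x i = 0)}"
    by (rule finite_set_of_finite_funs) auto
  ultimately have "finite (Poly_Mapping.lookup ` ?M)" by (rule finite_subset)
  then have M: "finite ?M"
    by (rule finite_imageD) (simp add: inj_on_def poly_mapping.lookup_inject)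
  have "Poly_Mapping.lookup ` (forms n :: 'k poly4 set) \<subseteq>
      {x. \<forall>m. (m \<in> ?M \<longrightarrow> x m \<in> UNIV) \<and> (m \<notin> ?M \<longrightarrow> x m = 0)}"
    by (auto simp: forms_def homogeneous_def in_keys_iff)
  moreover have "finite {x :: (4 \<Rightarrow>\<^sub>0 nat) \<Rightarrow> 'k. \<forall>m. (m \<in> ?M \<longrightarrow> x m \<in> UNIV) \<and> (m \<notin> ?M \<longrightarrow> x m = 0)}"
    using M by (rule finite_set_of_finite_funs) auto
  ultimately have "finite (Poly_Mapping.lookup ` (forms n :: 'k poly4 set))" by (rule finite_subset)
  then show ?thesis
    by (rule finite_imageD) (simp add: inj_on_def poly_mapping.lookup_inject)
qed

lemma subspace_forms: "poly4.subspace (forms n)"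
  by (rule poly4.subspaceI) (auto simp: forms_def homogeneous_add homogeneous_scale4)

lemma subspace_vanishing_forms: "poly4.subspace (vanishing_forms Z n)"
  by (rule poly4.subspaceI) (auto simp: vanishing_forms_iff homogeneous_add homogeneous_scale4
      ideal_of_0 ideal_of_add ideal_of_scale4)

text \<open>The truncated difference in \<open>hilbert_function\<close> is genuine: the vanishing
  forms lie among all forms, and comparing cardinalities compares dimensions.\<close>

lemma card_hilbert_function:
  fixes Z :: "'k::{field,finite} point set"
  shows "card (forms n :: 'k poly4 set) = CARD('k) ^ hilbert_function Z n * card (vanishing_forms Z n)"
proof -
  have sub: "vanishing_forms Z n \<subseteq> forms n" by (auto simp: vanishing_forms_def)
  then have fin: "finite (vanishing_forms Z n)" using finite_forms finite_subset by blast
  note F = card_poly4_subspace[OF finite_forms subspace_forms, of n, where 'k='k]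
  note I = card_poly4_subspace[OF fin subspace_vanishing_forms]
  have "card (vanishing_forms Z n) \<le> card (forms n :: 'k poly4 set)"
    using sub finite_forms card_mono by blast
  moreover have "card {0, 1 :: 'k} \<le> CARD('k)" by (rule card_mono) auto
  then have q: "CARD('k) > 1" by simp
  ultimately have "poly4.dim (vanishing_forms Z n) \<le> poly4.dim (forms n :: 'k poly4 set)"
    unfolding F I by simp
  then show ?thesis
    unfolding F I hilbert_function_def by (simp flip: power_add)
qed

section \<open>Independence of the jet conditions at distinct points\<close>

definition jet_forms ::
    "('p \<Rightarrow> 4 \<Rightarrow> 'k::field) \<Rightarrow> ('p \<Rightarrow> 4 \<Rightarrow> 'k) \<Rightarrow> nat \<Rightarrow> 'p set \<Rightarrow> 'k poly4 set" where
  "jet_forms y v n S =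
    {g \<in> forms n. \<forall>P\<in>S. Polynomial.monom 1 2 dvd eval_line (y P) (v P) g}"

lemma subspace_jet_forms: "poly4.subspace (jet_forms y v n S)"
  by (rule poly4.subspaceI) (auto simp: jet_forms_def forms_def homogeneous_add homogeneous_scale4
      eval_line_add eval_line_scale4 dvd_add dvd_smult)

text \<open>A new point \<open>P\<close> adds two conditions, its value and its derivative. Each
  cuts the space by a factor \<open>CARD('k)\<close>, because some form satisfying all earlier
  conditions violates it. Such forms are multiples of a product of squared linear forms vanishing at
  the old points but not at \<open>P\<close>.\<close>

lemma card_jet_forms:
  fixes y v :: "'p \<Rightarrow> 4 \<Rightarrow> 'k::{field,finite}" and s j :: "'p \<Rightarrow> 4"
  assumes "finite R" and ys: "\<And>P. P \<in> R \<Longrightarrow> y P (s P) = 1" and vs: "\<And>P. P \<in> R \<Longrightarrow> v P (s P) = 0"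
    and vj: "\<And>P. P \<in> R \<Longrightarrow> v P (j P) \<noteq> 0"
    and sep: "\<And>P Q. P \<in> R \<Longrightarrow> Q \<in> R \<Longrightarrow> P \<noteq> Q \<Longrightarrow> \<exists>i. y P i \<noteq> y Q i * y P (s Q)"
    and n: "2 * card R \<le> n"
  shows "CARD('k) ^ (2 * card R) * card (jet_forms y v n R) \<le> card (forms n :: 'k poly4 set)"
  using \<open>finite R\<close> ys vs vj sep n
proof (induction R rule: finite_induct)
  case empty
  show ?case by (simp add: jet_forms_def)
next
  case (insert P S)
  let ?L = "\<lambda>P. eval_line (y P) (v P)"
  let ?V = "jet_forms y v n S"
  \<comment> \<open>The hypothesis \<open>sep\<close> says that \<open>y P\<close> is not
    proportional to \<open>y Q\<close>; \<open>i Q\<close> is a coordinate that shows it.\<close>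
  obtain i where i: "\<And>Q. Q \<in> S \<Longrightarrow> y P (i Q) \<noteq> y Q (i Q) * y P (s Q)"
    using insert.prems(4)[of P] insert.hyps(2) by (metis insertCI)
  define l :: "'p \<Rightarrow> 'k poly4" where "l Q = Var (i Q) - scale4 (y Q (i Q)) (Var (s Q))" for Q
  have l_hom: "homogeneous 1 (l Q)" for Q
    unfolding l_def by (intro homogeneous_diff homogeneous_scale4 homogeneous_Var)
  have l_line: "?L A (l Q) = [:y A (i Q) - y Q (i Q) * y A (s Q), v A (i Q) - y Q (i Q) * v A (s Q):]" for A Q
    by (simp add: l_def eval_line_diff eval_line_scale4 eval_line_Var)
  have l_dvd: "Polynomial.monom 1 2 dvd ?L Q (l Q) ^ 2" if "Q \<in> S" for Q
    using insert.prems(1,2)[of Q] that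
    by (simp add: monom_2_dvd_iff l_line power2_eq_square coeff_mult)
  define r where "r = (\<Prod>Q\<in>S. l Q ^ 2)"
  have r_hom: "homogeneous (2 * card S) r"
    unfolding r_def using homogeneous_power[OF l_hom, where k=2] by (intro homogeneous_prod) simp
  have r_dvd: "Polynomial.monom 1 2 dvd ?L Q (r * g)" if "Q \<in> S" for Q g
  proof -
    have "?L Q (l Q) ^ 2 dvd ?L Q r"
      unfolding r_def eval_line_prod eval_line_power using insert.hyps(1) that by (rule dvd_prodI)
    then show ?thesis using l_dvd[OF that] by (simp add: eval_line_mult dvd_mult2 dvd_trans)
  qed
  have r_P: "Polynomial.coeff (?L P r) 0 \<noteq> 0"
    using i insert.hyps(1)
    by (simp add: r_def eval_line_prod eval_line_power l_line coeff_0_power poly_prod flip: poly_0_coeff_0)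
  have in_V: "r * g \<in> ?V" if "homogeneous (n - 2 * card S) g" for g
  proof -
    have "homogeneous n (r * g)"
      using homogeneous_mult[OF r_hom that] insert.prems(5) insert.hyps by simp
    then show ?thesis using r_dvd by (simp add: jet_forms_def forms_def)
  qed
  \<comment> \<open>The degree bound leaves room for a linear factor besides
    \<open>r\<close>.\<close>
  obtain k where k: "n - 2 * card S = Suc k"
    using insert.prems(5) insert.hyps by (cases "n - 2 * card S") auto
  have fin_V: "finite ?V" using finite_forms[of n] by (rule finite_subset[rotated]) (auto simp: jet_forms_def)
  \<comment> \<open>The value at \<open>P\<close> is imposed first, the derivative
    afterwards.\<close>
  define W where "W = {p \<in> ?V. Polynomial.coeff (?L P p) 0 = 0}"
  have W_sub: "poly4.subspace W"
    using subspace_jet_forms[of y v n S] unfolding W_def poly4.subspace_def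
    by (auto simp: eval_line_add eval_line_scale4)
  \<comment> \<open>Powers of this variable fill up the degree without changing the restriction to
    the line.\<close>
  have line_s: "?L P (Var (s P)) = 1"
    using insert.prems(1,2)[of P] by (simp add: eval_line_Var)
  have V_W: "CARD('k) * card W \<le> card ?V"
    unfolding W_def
  proof (rule card_kernel_le[OF fin_V subspace_jet_forms])
    show "r * Var (s P) ^ (n - 2 * card S) \<in> ?V"
      using homogeneous_power[OF homogeneous_Var, where k="n - 2 * card S"] by (intro in_V) simp
    show "Polynomial.coeff (?L P (r * Var (s P) ^ (n - 2 * card S))) 0 \<noteq> 0"
      using r_P by (simp add: eval_line_mult eval_line_power line_s)
  qed (simp_all add: eval_line_add eval_line_scale4)
  have W_jet: "CARD('k) * card {p \<in> W. Polynomial.coeff (?L P p) 1 = 0} \<le> card W"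
  proof (rule card_kernel_le[OF _ W_sub])
    \<comment> \<open>This linear form vanishes at \<open>P\<close> with nonzero derivative along
      \<open>v P\<close>, so its product with \<open>r\<close> lies in \<open>W\<close> and violates
      the derivative condition.\<close>
    define a :: "'k poly4" where "a = Var (j P) - scale4 (y P (j P)) (Var (s P))"
    define g where "g = a * Var (s P) ^ k"
    have line_a: "?L P a = [:0, v P (j P):]"
      using insert.prems(1,2)[of P] by (simp add: a_def eval_line_diff eval_line_scale4 eval_line_Var)
    then have line_g: "?L P (r * g) = ?L P r * [:0, v P (j P):]"
      by (simp add: g_def eval_line_mult eval_line_power line_s del: mult_pCons_right)
    have "homogeneous 1 a"
      unfolding a_def by (intro homogeneous_diff homogeneous_scale4 homogeneous_Var)
    then have "homogeneous (n - 2 * card S) g"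
      using homogeneous_mult[OF _ homogeneous_power[OF homogeneous_Var, where k=k]]
      unfolding g_def k by fastforce
    then show "r * g \<in> W" using in_V by (simp add: W_def line_g)
    show "Polynomial.coeff (?L P (r * g)) 1 \<noteq> 0"
      using r_P insert.prems(3)[of P] by (simp add: line_g)
    show "finite W" using fin_V by (simp add: W_def)
  qed (simp_all add: eval_line_add eval_line_scale4)
  have jet_eq: "{p \<in> W. Polynomial.coeff (?L P p) 1 = 0} = jet_forms y v n (insert P S)"
    by (auto simp: W_def jet_forms_def monom_2_dvd_iff)
  have "CARD('k) * (CARD('k) * card (jet_forms y v n (insert P S))) \<le> card ?V"
    by (rule order_trans[OF mult_le_mono2[OF W_jet[unfolded jet_eq]] V_W])
  then have "CARD('k) ^ (2 * card S) * (CARD('k) * (CARD('k) * card (jet_forms y v n (insert P S))))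
      \<le> CARD('k) ^ (2 * card S) * card ?V"
    by (rule mult_le_mono2)
  also have "\<dots> \<le> card (forms n :: 'k poly4 set)"
    using insert by (intro insert.IH) auto
  finally show ?case
    using insert.hyps by (simp add: mult_ac)
qed

text \<open>By primality, two values of \<open>b\<close> giving the same \<open>a + h * b\<close>
  differ by a vanishing form of degree \<open>n - m\<close>, so the fibres of this map into
  \<open>K\<close> have at most as many elements as there are such forms. Counting pairs
  \<open>(a, b)\<close> bounds \<open>card K\<close> from below; the bound from above then compares
  the exponents of \<open>CARD('k)\<close>.\<close>

lemma hilbert_function_jump:
  fixes C :: "'k::{field,finite} point set"
  assumes C: "irreducible_variety C" and h: "homogeneous m h" "h \<notin> ideal_of C"
    and jets: "\<And>a b. a \<in> vanishing_forms C n \<Longrightarrow> b \<in> forms (n - m) \<Longrightarrow> a + h * b \<in> K"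
    and K: "finite K" "CARD('k) ^ r * card K \<le> card (forms n :: 'k poly4 set)"
  shows "r + hilbert_function C (n - m) \<le> hilbert_function C n"
proof -
  let ?q = "CARD('k)" and ?I = "vanishing_forms C n" and ?I' = "vanishing_forms C (n - m)"
  let ?F' = "forms (n - m) :: 'k poly4 set"
  have fin: "finite (vanishing_forms C k)" for k
    using finite_forms[of k] by (rule finite_subset[rotated]) (auto simp: vanishing_forms_def)
  \<comment> \<open>A reference point is fixed in each fibre; the second component of
    \<open>?g\<close> is the offset from it, which makes \<open>?g\<close> injective.\<close>
  define \<sigma> where "\<sigma> p = (SOME b. b \<in> ?F' \<and> (\<exists>a\<in>?I. p = a + h * b))" for p
  let ?g = "\<lambda>(a, b). (a + h * b, b - \<sigma> (a + h * b))"
  have "b - \<sigma> (a + h * b) \<in> ?I'" if "a \<in> ?I" "b \<in> ?F'" for a b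
  proof -
    have "\<sigma> (a + h * b) \<in> ?F' \<and> (\<exists>a'\<in>?I. a + h * b = a' + h * \<sigma> (a + h * b))"
      unfolding \<sigma>_def by (rule someI[of _ b]) (use that in blast)
    then obtain a' where *: "\<sigma> (a + h * b) \<in> ?F'" "a' \<in> ?I" "a + h * b = a' + h * \<sigma> (a + h * b)"
      by blast
    have "h * (b - \<sigma> (a + h * b)) = a' - a"
      using *(3) by (simp add: algebra_simps)
    moreover have "a' - a \<in> ideal_of C"
      using that *(2) by (simp add: vanishing_forms_iff ideal_of_diff)
    moreover have hom: "homogeneous (n - m) (b - \<sigma> (a + h * b))"
      using that *(1) by (simp add: forms_def homogeneous_diff)
    ultimately have "b - \<sigma> (a + h * b) \<in> ideal_of C"
      using ideal_of_prime[OF C h(1) hom] h(2) by simp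
    with hom show ?thesis by (simp add: vanishing_forms_iff)
  qed
  then have "?g ` (?I \<times> ?F') \<subseteq> K \<times> ?I'" using jets by auto
  moreover have "inj_on ?g (?I \<times> ?F')" by (auto intro: inj_onI)
  ultimately have "card (?I \<times> ?F') \<le> card (K \<times> ?I')"
    using K(1) fin card_inj_on_le by blast
  then have "card ?I * (?q ^ hilbert_function C (n - m) * card ?I') \<le> card K * card ?I'"
    by (simp add: card_cartesian_product card_hilbert_function[of "n - m" C])
  moreover have pos: "card (vanishing_forms C k) > 0" for k
  proof -
    have "0 \<in> vanishing_forms C k" by (simp add: vanishing_forms_iff ideal_of_0)
    then show ?thesis using fin[of k] card_gt_0_iff by blast
  qed
  ultimately have "card ?I * ?q ^ hilbert_function C (n - m) \<le> card K"
    using pos[of "n - m"] by (simp flip: mult.assoc)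
  then have "?q ^ r * (card ?I * ?q ^ hilbert_function C (n - m)) \<le> card (forms n :: 'k poly4 set)"
    using K(2) by (meson mult_le_mono2 order_trans)
  then have "?q ^ (r + hilbert_function C (n - m)) * card ?I \<le> ?q ^ hilbert_function C n * card ?I"
    by (simp add: card_hilbert_function[of n C] power_add mult_ac)
  then have le: "?q ^ (r + hilbert_function C (n - m)) \<le> ?q ^ hilbert_function C n"
    using pos[of n] by simp
  have "card {0, 1 :: 'k} \<le> ?q" by (rule card_mono) auto
  then have "?q > 1" by simp
  then show ?thesis using le by simp
qed

subsection \<open>Rational points on Frobenius classical surfaces\<close>

lemma variety_dim_geI:
  assumes "\<And>i. i \<le> n \<Longrightarrow> irreducible_variety (W i) \<and> W i \<subseteq> Z" "\<And>i. i < n \<Longrightarrow> W i \<subset> W (Suc i)"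
  shows "enat n \<le> variety_dim Z"
  unfolding variety_dim_def using assms by (intro Sup_upper) blast

lemma variety_dim_posD:
  assumes "variety_dim Z \<noteq> 0"
  obtains V W where "irreducible_variety V" "irreducible_variety W" "V \<subset> W" "W \<subseteq> Z"
proof -
  define A where "A = {enat n | n. \<exists>W. (\<forall>i\<le>n. irreducible_variety (W i) \<and> W i \<subseteq> Z) \<and>
                          (\<forall>i<n. W i \<subset> W (Suc i))}"
  have "\<exists>a\<in>A. a \<noteq> 0"
  proof (rule ccontr)
    assume "\<not> (\<exists>a\<in>A. a \<noteq> 0)"
    then have "\<forall>a\<in>A. a = 0" by simp
    then have "Sup A \<le> 0" by (intro Sup_least) simp
    with assms show False by (simp add: variety_dim_def A_def)
  qed
  then obtain n W where "n \<noteq> 0" "\<forall>i\<le>n. irreducible_variety (W i) \<and> W i \<subseteq> Z" "\<forall>i<n. W i \<subset> W (Suc i)"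
    by (auto simp: A_def zero_enat_def)
  then show thesis using that[of "W 0" "W (Suc 0)"] by auto
qed

text \<open>Otherwise \<open>C\<close> would lie in the Frobenius locus without being a component,
  hence properly inside an irreducible \<open>D\<close> in the locus. A chain of length 1 in
  \<open>C\<close> followed by \<open>D\<close> has length 2, against dimension 1.\<close>

lemma frobenius_form_not_in_ideal:
  assumes f: "homogeneous d f" and "frobenius_classical f"
    and C: "irreducible_variety C" "variety_dim C = 1" "C \<subseteq> surface f"
    and not_comp: "\<not> irreducible_component C (frobenius_locus f)"
  shows "frobenius_form f \<notin> ideal_of C"
proof
  assume h: "frobenius_form f \<in> ideal_of C"
  have closed: "zariski_closed C" using C by (simp add: irreducible_variety_def)
  have "f \<in> ideal_of C"
    using C(3) subset_zero_locus_iff[OF closed, of "{f}"] f by (auto simp: surface_def)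
  then have C_locus: "C \<subseteq> frobenius_locus f"
    unfolding frobenius_locus_def
    using subset_zero_locus_iff[OF closed, of "{f, frobenius_form f}"] h f
      homogeneous_frobenius_form[OF f] by blast
  then obtain D where D: "irreducible_variety D" "C \<subseteq> D" "D \<subseteq> frobenius_locus f" "D \<noteq> C"
    using not_comp C(1) unfolding irreducible_component_def by blast
  have "variety_dim C \<noteq> 0" using C(2) by simp
  then obtain V W where VW: "irreducible_variety V" "irreducible_variety W" "V \<subset> W" "W \<subseteq> C"
    by (rule variety_dim_posD)
  define U where "U i = (if i = 0 then V else if i = 1 then W else D)" for i :: nat
  have "enat 2 \<le> variety_dim (frobenius_locus f)"
  proof (rule variety_dim_geI)
    show "irreducible_variety (U i) \<and> U i \<subseteq> frobenius_locus f" for i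
      using VW D C_locus by (auto simp: U_def)
    show "U i \<subset> U (Suc i)" if "i < 2" for i
      using VW D that by (auto simp: U_def less_2_cases_iff)
  qed
  then show False
    using assms(2) by (simp add: frobenius_classical_def one_enat_def)
qed

theorem theorem2p5:
  fixes f :: "'k::{field,finite} poly4"
    and C :: "'k point set"
    and d \<delta> :: nat
  assumes "homogeneous d f" and "Factorial_Ring.irreducible f" and "d > 1"
    and "frobenius_classical f"
    and "irreducible_variety C" and "variety_dim C = 1" and "has_curve_degree C \<delta>"
    and "C \<subseteq> surface f"
    and "\<not> irreducible_component C (frobenius_locus f)"
  shows "real (card (rational_points C)) \<le> real \<delta> * (real d + real CARD('k) - 1) / 2"
proof (cases "finite (rational_points C)")
  case True
  let ?R = "rational_points C"
  define h where "h = frobenius_form f"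
  define m where "m = CARD('k) + (d - 1)"
  have closed: "zariski_closed C" using assms by (simp add: irreducible_variety_def)
  have f: "f \<in> vanishing_forms C d"
    using assms(1,8) subset_zero_locus_iff[OF closed, of "{f}"]
    by (auto simp: surface_def vanishing_forms_iff)
  have h: "homogeneous m h" "h \<notin> ideal_of C"
    using homogeneous_frobenius_form[OF assms(1)]
      frobenius_form_not_in_ideal[OF assms(1,4,5,6,8,9)]
    by (simp_all add: h_def m_def)
  \<comment> \<open>Positive dimension ensures that \<open>C\<close> is not a single point, as
    \<open>tangent_direction\<close> demands.\<close>
  have "variety_dim C \<noteq> 0" using assms(6) by simp
  then obtain V W where VW: "irreducible_variety V" "V \<subset> W" "W \<subseteq> C"
    by (rule variety_dim_posD)
  then have "V \<noteq> {}" by (simp add: irreducible_variety_def)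
  then have not_single: "C \<noteq> {P}" for P using VW by blast
  define tangent where "tangent P y s v j \<longleftrightarrow>
      P = proj_point (\<lambda>i. to_ac (y i)) \<and> y s = 1 \<and> v s = 0 \<and> v j \<noteq> 0 \<and>
      (\<forall>n. \<forall>g\<in>vanishing_forms C n. Polynomial.monom 1 2 dvd eval_line y v g)" for P y s v j
  have "\<exists>y s v j. tangent P y s v j" if P: "P \<in> ?R" for P
  proof -
    obtain y s where y: "P = proj_point (\<lambda>i. to_ac (y i))" "y s = 1"
      using rational_points_normalised[OF P] by blast
    have "proj_point (\<lambda>i. to_ac (y i)) \<in> C" using P y by (simp add: rational_points_def)
    then obtain v j where "v s = 0" "v j \<noteq> 0"
      and "\<And>n g. g \<in> vanishing_forms C n \<Longrightarrow> Polynomial.monom 1 2 dvd eval_line y v g"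
      by (rule tangent_direction[of C y s, OF assms(5) _ y(2) not_single]) (rule that)
    with y have "tangent P y s v j" by (simp add: tangent_def)
    then show ?thesis by blast
  qed
  then obtain y s v j where tangent: "\<And>P. P \<in> ?R \<Longrightarrow> tangent P (y P) (s P) (v P) (j P)"
    by metis
  have P_eq: "P = proj_point (\<lambda>i. to_ac (y P i))" and ys: "y P (s P) = 1"
    and vs: "v P (s P) = 0" and vj: "v P (j P) \<noteq> 0"
    and jet: "g \<in> vanishing_forms C n \<Longrightarrow> Polynomial.monom 1 2 dvd eval_line (y P) (v P) g"
    if "P \<in> ?R" for P n g
    using tangent[OF that] unfolding tangent_def by blast+
  have sep: "\<exists>i. y P i \<noteq> y Q i * y P (s Q)" if "P \<in> ?R" "Q \<in> ?R" "P \<noteq> Q" for P Q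
  proof (rule ccontr)
    \<comment> \<open>Then \<open>y P\<close> is a multiple of \<open>y Q\<close>, so the two points
      coincide.\<close>
    assume "\<not> (\<exists>i. y P i \<noteq> y Q i * y P (s Q))"
    then have eq: "y P i = y P (s Q) * y Q i" for i by (metis mult.commute)
    then have "y P (s Q) \<noteq> 0" using ys[OF that(1)] by (metis mult_zero_left zero_neq_one)
    have "P = proj_point (\<lambda>i. to_ac (y P i))" using P_eq that by blast
    also have "(\<lambda>i. to_ac (y P i)) = (\<lambda>i. to_ac (y P (s Q)) * to_ac (y Q i))"
      by (subst eq) simp
    also have "proj_point \<dots> = Q"
      using \<open>y P (s Q) \<noteq> 0\<close> P_eq[OF that(2)] by (simp add: proj_point_scale)
    finally show False using that by simp
  qed
  obtain c N where deg: "\<And>n. n \<ge> N \<Longrightarrow> int (hilbert_function C n) = int \<delta> * int n + c"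
    using assms(7) by (auto simp: has_curve_degree_def eventually_sequentially)
  \<comment> \<open>Both \<open>n\<close> and \<open>n - m\<close> are at least \<open>N\<close>,
    where the Hilbert polynomial takes over, and \<open>n\<close> is large enough for the jet
    conditions to be independent.\<close>
  define n where "n = N + m + 2 * card ?R"
  let ?K = "jet_forms y v n ?R"
  have "2 * card ?R + hilbert_function C (n - m) \<le> hilbert_function C n"
  proof (rule hilbert_function_jump[OF assms(5) h])
    show "a + h * b \<in> ?K" if a: "a \<in> vanishing_forms C n" and b: "b \<in> forms (n - m)" for a b
    proof -
      have "homogeneous n (h * b)"
        using homogeneous_mult[OF h(1), of "n - m" b] b by (simp add: forms_def n_def add_ac)
      moreover have "Polynomial.monom 1 2 dvd eval_line (y P) (v P) (a + h * b)" if "P \<in> ?R" for P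
        \<comment> \<open>The form \<open>f\<close> vanishes on \<open>C\<close>, so it has the
          required jets, and \<open>frobenius_form_jet\<close> passes them on to
          \<open>h\<close>.\<close>
        unfolding eval_line_add eval_line_mult h_def
        by (intro dvd_add dvd_mult2 jet[OF that a] frobenius_form_jet[OF assms(1)] jet[OF that f])
      ultimately show ?thesis
        using a by (simp add: jet_forms_def forms_def vanishing_forms_iff homogeneous_add)
    qed
    show "finite ?K"
      using finite_forms[of n] by (rule finite_subset[rotated]) (auto simp: jet_forms_def)
    show "CARD('k) ^ (2 * card ?R) * card ?K \<le> card (forms n :: 'k poly4 set)"
      using ys vs vj sep by (intro card_jet_forms[OF True, of y s v j]) (auto simp: n_def)
  qed
  moreover have "int (hilbert_function C n) = int \<delta> * int n + c"
    "int (hilbert_function C (n - m)) = int \<delta> * int (n - m) + c"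
    by (rule deg, simp add: n_def)+
  \<comment> \<open>The constant \<open>c\<close> cancels between the two values, leaving
    \<open>\<delta> * m\<close>.\<close>
  moreover have "int \<delta> * int n = int \<delta> * int (n - m) + int (\<delta> * m)"
    by (simp add: n_def algebra_simps)
  ultimately have "2 * card ?R \<le> \<delta> * m" by linarith
  then have "real (2 * card ?R) \<le> real (\<delta> * m)" by (simp only: of_nat_le_iff)
  moreover have "real m = real d + real CARD('k) - 1" using assms(3) by (simp add: m_def of_nat_diff)
  ultimately show ?thesis by simp
next
  case False
  \<comment> \<open>An infinite set has \<open>card\<close> 0, so it is enough that the right-hand
    side is nonnegative.\<close>
  then show ?thesis using assms(3) by simp
qed

end
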